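(* Let $q=p^h$ be a power of a prime $p>3$. Then there are at least $\frac{q-22\sqrt{q}-79}{6}$ pairs $(A,B)\in \mathbb{F}_q^2$ with $A^3+B^2-B+1=0$ and $B\neq 0,-1$ such that the polynomial $$f_{2}(x)=x^{q^2+q-1}+Ax^{q^3-q^2+q}+Bx$$ is a permutation polynomial of $\mathbb{F}_{q^3}$.
   Context: $\mathbb{F}_{q}$ denotes the finite field with $q$ elements. A polynomial is a permutation polynomial of a finite field if the map it induces by evaluation on that field is a bijection. *)

theory Defs
  imports Complex_Main "HOL-Computational_Algebra.Computational_Algebra"
begin

definition is_subfield :: "'a::field set \<Rightarrow> bool" where
  "is_subfield F \<longleftrightarrow>
     0 \<in> F \<and> 1 \<in> F \<and>
     (\<forall>x\<in>F. \<forall>y\<in>F. x + y \<in> F \<and> x * y \<in> F) \<and>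
     (\<forall>x\<in>F. - x \<in> F \<and> inverse x \<in> F)"

definition permutation_poly :: "'a::finite_field poly \<Rightarrow> bool" where
  "permutation_poly f \<longleftrightarrow> bij (poly f)"

text \<open>
  The natural-number subtractions in the exponents do not truncate for \<open>q > 0\<close>.
\<close>

definition f2 :: "nat \<Rightarrow> 'a::finite_field \<Rightarrow> 'a \<Rightarrow> 'a poly" where
  "f2 q A B = monom 1 (q ^ 2 + q - 1) + monom A (q ^ 3 - q ^ 2 + q) + monom B 1"

end

theory Submission
  imports "HOL-Algebra.Algebraic_Closure_Type" "HOL-Number_Theory.Residues" Defs
begin

text \<open>
  Put \<open>a = x ^ (q\<^sup>2 + q)\<close>, \<open>b = a ^ q\<close>, \<open>c = b ^ q\<close> and let \<open>n\<close> be the norm of \<open>x\<close>. Then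
  \<open>n f\<^sub>2(x) = a\<^sup>2 + A c\<^sup>2 + B b c\<close>. On the curve \<open>A\<^sup>3 + B\<^sup>2 - B + 1 = 0\<close> this quadratic map is, over the
  algebraic closure, equivalent to the twisted field multiplication \<open>(y\<^sub>0 y\<^sub>1, y\<^sub>1 y\<^sub>2, y\<^sub>2 y\<^sub>0)\<close> of three
  linear forms, defined with the help of a cube root of
  \<open>H(B) = (B + w\<^sup>2) (B - 2 w) / ((B + w) (B - 2 w\<^sup>2))\<close> where \<open>w\<close> is a primitive cube root of unity. The
  Frobenius map permutes the three forms cyclically, and \<open>f\<^sub>2\<close> is a permutation polynomial as soon
  as it does not fix them; this excludes one of the three cubic residue classes of \<open>H(B)\<close>.

  It remains to bound the number of \<open>B\<close> in the excluded class. Since asymptotically two thirds of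
  all pairs are good while only one sixth is asked for, a weak bound suffices: Stepanov's method
  with multiplicity \<open>4\<close> shows that each cubic residue class of the functions involved contains at
  most \<open>q / 2 + 9\<close> elements. The number of points of the curve itself comes from a Jacobi sum.
\<close>

section \<open>Stepanov's method\<close>

text \<open>Gaussian elimination: the new equation is either identically zero or serves to eliminate
  one unknown from all the others.\<close>

lemma exists_nontrivial_solution:
  fixes c :: "'j \<Rightarrow> 'i \<Rightarrow> 'b::field"
  assumes "finite J" "finite I" "card J < card I"
  shows "\<exists>x. (\<exists>i\<in>I. x i \<noteq> 0) \<and> (\<forall>j\<in>J. (\<Sum>i\<in>I. c j i * x i) = 0)"
  using assms
proof (induction J arbitrary: I c rule: finite_induct)
  case empty
  then obtain i where "i \<in> I" by (metis card.empty ex_in_conv less_irrefl)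
  then show ?case by (intro exI[of _ "\<lambda>_. 1"]) auto
next
  case (insert j J)
  show ?case
  proof (cases "\<forall>i\<in>I. c j i = 0")
    case True
    have "card J < card I" using insert by simp
    then obtain x where "\<exists>i\<in>I. x i \<noteq> 0" "\<forall>j\<in>J. (\<Sum>i\<in>I. c j i * x i) = 0"
      using insert.IH[of I c] insert.prems by blast
    then show ?thesis using True by (intro exI[of _ x]) auto
  next
    case False
    then obtain i0 where i0: "i0 \<in> I" "c j i0 \<noteq> 0" by blast
    let ?I = "I - {i0}"
    define c' where "c' j' i = c j' i - c j' i0 * c j i / c j i0" for j' i
    have "card J < card ?I" using insert i0 by simp
    then obtain x where x: "\<exists>i\<in>?I. x i \<noteq> 0" "\<And>j'. j' \<in> J \<Longrightarrow> (\<Sum>i\<in>?I. c' j' i * x i) = 0"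
      using insert.IH[of ?I c'] insert.prems by blast
    define u where "u = (\<Sum>i\<in>?I. c j i * x i)"
    define y where "y = x(i0 := - u / c j i0)"
    have split: "(\<Sum>i\<in>I. c j' i * y i) = c j' i0 * (- u / c j i0) + (\<Sum>i\<in>?I. c j' i * x i)" for j'
    proof -
      have "(\<Sum>i\<in>I. c j' i * y i) = c j' i0 * y i0 + (\<Sum>i\<in>?I. c j' i * y i)"
        using insert.prems i0 by (simp add: sum.remove)
      then show ?thesis by (simp add: y_def)
    qed
    have "(\<Sum>i\<in>I. c j' i * y i) = 0" if "j' \<in> insert j J" for j'
    proof (cases "j' = j")
      case True
      then show ?thesis using split[of j] i0 by (simp add: u_def)
    next
      case False
      with that have "0 = (\<Sum>i\<in>?I. c' j' i * x i)" using x by simp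
      also have "\<dots> = (\<Sum>i\<in>?I. c j' i * x i) - c j' i0 / c j i0 * u"
        by (simp add: c'_def u_def algebra_simps sum_subtractf sum_distrib_left)
      finally show ?thesis using split[of j'] by (simp add: algebra_simps)
    qed
    moreover have "\<exists>i\<in>I. y i \<noteq> 0" using x(1) by (auto simp: y_def)
    ultimately show ?thesis by blast
  qed
qed

text \<open>Each step lowers the order at \<open>z\<close> by exactly one and multiplies the
  cofactor's value at \<open>z\<close> by \<open>poly D z\<close> and the current exponent, both
  nonzero.\<close>

lemma derivation_iterate_nonzero:
  fixes S D :: "'b::field poly"
  assumes "poly S z \<noteq> 0" "poly D z \<noteq> 0" "\<And>j. 0 < j \<Longrightarrow> j \<le> m \<Longrightarrow> of_nat j \<noteq> (0::'b)"
  shows "poly (((\<lambda>f. D * pderiv f) ^^ m) ([:-z, 1:] ^ m * S)) z \<noteq> 0"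
  using assms
proof (induction m arbitrary: S)
  case 0
  then show ?case by simp
next
  case (Suc m)
  define S1 where "S1 = D * (smult (of_nat (Suc m)) S + [:-z, 1:] * pderiv S)"
  have d1: "pderiv [:-z, 1:] = 1" by (simp add: pderiv_pCons)
  have "D * pderiv ([:-z, 1:] ^ Suc m * S) = [:-z, 1:] ^ m * S1"
    unfolding pderiv_mult pderiv_power_Suc d1 S1_def
    by (simp add: algebra_simps smult_add_left del: mult_pCons_left mult_pCons_right)
  moreover have "poly S1 z \<noteq> 0"
    using Suc.prems(1,2) Suc.prems(3)[of "Suc m"] by (simp add: S1_def)
  ultimately show ?case
    using Suc.IH[of S1] Suc.prems by (simp add: funpow_swap1 del: power_Suc funpow.simps(2)
      add: funpow_Suc_right)
qed

lemma multiple_root_of_derivation: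
  fixes R D :: "'b::field poly"
  assumes "R \<noteq> 0" "poly D z \<noteq> 0" "\<And>j. 0 < j \<Longrightarrow> j < M \<Longrightarrow> of_nat j \<noteq> (0::'b)"
    and "\<And>j. j < M \<Longrightarrow> poly (((\<lambda>f. D * pderiv f) ^^ j) R) z = 0"
  shows "M \<le> order z R"
proof (rule ccontr)
  assume less: "\<not> M \<le> order z R"
  obtain S where S: "R = [:-z, 1:] ^ order z R * S" "\<not> [:-z, 1:] dvd S"
    using order_decomp[OF assms(1)] by blast
  then have "poly S z \<noteq> 0" by (simp add: poly_eq_0_iff_dvd)
  then have "poly (((\<lambda>f. D * pderiv f) ^^ order z R) ([:-z, 1:] ^ order z R * S)) z \<noteq> 0"
    using assms less by (intro derivation_iterate_nonzero) auto
  then show False using assms(4)[of "order z R"] less S(1) by simp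
qed

text \<open>Only the summand of least order \<open>m\<close> is not divisible by
  \<open>[:-z, 1:] ^ Suc m\<close>, so the others cannot cancel it.\<close>

lemma sum_nonzero_of_distinct_orders:
  fixes f :: "'i \<Rightarrow> 'b::field poly"
  assumes "finite I" "I \<noteq> {}" "\<And>i. i \<in> I \<Longrightarrow> f i \<noteq> 0" "inj_on (\<lambda>i. order z (f i)) I"
  shows "(\<Sum>i\<in>I. f i) \<noteq> 0"
proof
  assume sum0: "(\<Sum>i\<in>I. f i) = 0"
  define m where "m = Min ((\<lambda>i. order z (f i)) ` I)"
  have "m \<in> (\<lambda>i. order z (f i)) ` I" unfolding m_def using assms by (intro Min_in) auto
  then obtain i where i: "i \<in> I" "order z (f i) = m" by auto
  have "[:-z, 1:] ^ Suc m dvd f j" if "j \<in> I - {i}" for j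
  proof -
    have "m \<le> order z (f j)" using that assms unfolding m_def by (intro Min_le) auto
    moreover have "m \<noteq> order z (f j)" using that i assms(4) by (auto simp: inj_on_def)
    ultimately show ?thesis by (intro order_divides[THEN iffD2]) auto
  qed
  then have "[:-z, 1:] ^ Suc m dvd (\<Sum>j\<in>I - {i}. f j)" by (rule dvd_sum)
  moreover have "f i = - (\<Sum>j\<in>I - {i}. f j)"
    using sum0 assms(1) i by (simp add: sum.remove eq_neg_iff_add_eq_0)
  ultimately have "[:-z, 1:] ^ Suc m dvd f i" by simp
  then show False using i assms(3) order_divides[of z "Suc m" "f i"] by auto
qed

lemma sum_order_le_degree:
  fixes R :: "'b::field poly"
  assumes "finite Z" "R \<noteq> 0" "\<And>z. z \<in> Z \<Longrightarrow> M \<le> order z R"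
  shows "M * card Z \<le> degree R"
  using assms
proof (induction Z arbitrary: R rule: finite_induct)
  case (insert z Z)
  have "[:-z, 1:] ^ M dvd R" using insert.prems by (simp add: order_divides)
  then obtain S where S: "R = [:-z, 1:] ^ M * S" by (elim dvdE)
  with insert.prems have "S \<noteq> 0" by auto
  have "M \<le> order y S" if "y \<in> Z" for y
  proof -
    have "order y ([:-z, 1:] ^ M) = 0"
      using that insert.hyps by (intro order_0I) auto
    then have "order y R = order y S"
      using S insert.prems(1) by (simp add: order_mult)
    then show ?thesis using that insert.prems(2)[of y] by simp
  qed
  then have "M * card Z \<le> degree S" using insert.IH \<open>S \<noteq> 0\<close> by blast
  moreover have "degree R = M + degree S"
    using S \<open>S \<noteq> 0\<close> by (simp add: degree_mult_eq degree_linear_power)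
  ultimately show ?case using insert.hyps by simp
qed simp

lemma pderiv_sum:
  "pderiv (\<Sum>i\<in>A. f i) = (\<Sum>i\<in>A. pderiv (f i :: 'b::idom poly))"
  by (induction A rule: infinite_finite_induct) (simp_all add: pderiv_add)

lemma degree_pderiv_le: "degree (pderiv P) \<le> degree (P :: 'b::field poly) - 1"
  by (rule degree_le) (auto simp: coeff_pderiv coeff_eq_0)

lemma degree_derivation_le:
  fixes P :: "'b::field poly"
  assumes "degree D \<le> Suc s" "degree g \<le> s"
  shows "degree (D * pderiv P + g * P) \<le> degree P + s"
proof (rule degree_add_le)
  show "degree (D * pderiv P) \<le> degree P + s"
  \<comment> \<open>For constant \<open>P\<close> the subtraction in \<open>degree P - 1\<close>
    truncates, but then the derivative vanishes.\<close>
  proof (cases "degree P = 0")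
    case True
    then obtain c where "P = [:c:]" by (elim degree_eq_zeroE)
    then show ?thesis by (simp add: pderiv_pCons)
  next
    case False
    have "degree (D * pderiv P) \<le> degree D + degree (pderiv P)" by (rule degree_mult_le)
    also have "\<dots> \<le> Suc s + (degree P - 1)" using assms(1) degree_pderiv_le[of P] by linarith
    finally show ?thesis using False by linarith
  qed
  show "degree (g * P) \<le> degree P + s"
    using degree_mult_le[of g P] assms(2) by linarith
qed

text \<open>
  The operator \<open>f \<mapsto> D f'\<close> replaces the derivative, because it maps \<open>\<Psi> r * P\<close> to \<open>\<Psi> r * T P\<close> with
  a polynomial \<open>T P\<close> of slightly larger degree. The gaps between the \<open>k r\<close> guarantee that the
  auxiliary polynomial is not zero: its summands have different orders at \<open>\<theta>\<close>.
\<close>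

lemma stepanov:
  fixes \<Psi> g \<mu> E :: "nat \<Rightarrow> 'b::field poly" and D :: "'b poly"
  assumes fin: "finite Z" and degD: "degree D \<le> Suc s"
    and degg: "\<And>r. r < n \<Longrightarrow> degree (g r) \<le> s"
    and deriv: "\<And>r. r < n \<Longrightarrow> D * pderiv (\<Psi> r) = g r * \<Psi> r"
    and val: "\<And>r z. r < n \<Longrightarrow> z \<in> Z \<Longrightarrow> poly (\<Psi> r) z = poly (\<mu> r) z"
    and deg\<mu>: "\<And>r. r < n \<Longrightarrow> degree (\<mu> r) \<le> d"
    and D0: "\<And>z. z \<in> Z \<Longrightarrow> poly D z \<noteq> 0"
    and char: "\<And>j. 0 < j \<Longrightarrow> j < M \<Longrightarrow> of_nat j \<noteq> (0::'b)"
    and \<Psi>: "\<And>r. r < n \<Longrightarrow> \<Psi> r = [:-\<theta>, 1:] ^ k r * E r"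
    and E0: "\<And>r. r < n \<Longrightarrow> poly (E r) \<theta> \<noteq> 0"
    and gap: "\<And>r r'. r < n \<Longrightarrow> r' < n \<Longrightarrow> r \<noteq> r' \<Longrightarrow> k r + a \<le> k r' \<or> k r' + a \<le> k r"
    and deg\<Psi>: "\<And>r. r < n \<Longrightarrow> degree (\<Psi> r) \<le> N"
    and room: "(\<Sum>j<M. a + d + s * j) < n * a"
  shows "M * card Z < N + a"
proof -
  define T where "T r = (\<lambda>P. D * pderiv P + g r * P)" for r
  define \<delta> where "\<delta> = (\<lambda>f. D * pderiv f)"
  have T_add: "(T r ^^ j) (P + Q) = (T r ^^ j) P + (T r ^^ j) Q" for r j P Q
    by (induction j) (simp_all add: T_def pderiv_add algebra_simps)
  have T_0: "(T r ^^ j) 0 = 0" for r j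
    by (induction j) (simp_all add: T_def)
  have T_smult: "(T r ^^ j) (smult c P) = smult c ((T r ^^ j) P)" for r j c P
    by (induction j) (simp_all add: T_def pderiv_smult algebra_simps smult_add_right)
  have T_sum: "(T r ^^ j) (\<Sum>i\<in>A. f i) = (\<Sum>i\<in>A. (T r ^^ j) (f i))" if "finite A" for r j f and A :: "nat set"
    using that by (induction A rule: finite_induct) (simp_all add: T_0 T_add)
  have deg_T: "degree ((T r ^^ j) P) \<le> degree P + s * j" if "r < n" for r j P
  proof (induction j)
    case (Suc j)
    have "degree ((T r ^^ Suc j) P) \<le> degree ((T r ^^ j) P) + s"
      using degree_derivation_le[OF degD degg[OF that]] by (simp add: T_def)
    with Suc show ?case by simp
  qed simp

  \<comment> \<open>The unknowns, indexed by \<open>I\<close>, are the coefficients of polynomials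
    \<open>P r\<close> of degree below \<open>a\<close>. The conditions in \<open>J\<close> kill,
    for each \<open>j < M\<close>, all coefficients of the polynomial that agrees with the
    \<open>j\<close>-th iterate on \<open>Z\<close> once \<open>\<Psi> r\<close> is exchanged for
    \<open>\<mu> r\<close>; its degree is below \<open>a + d + s * j\<close>.\<close>
  define J where "J = (SIGMA j:{..<M}. {..<a + d + s * j})"
  define I where "I = {..<n} \<times> {..<a}"
  define c where "c jm ri = coeff ((T (fst ri) ^^ fst jm) (monom 1 (snd ri)) * \<mu> (fst ri)) (snd jm)"
    for jm ri :: "nat \<times> nat"
  have "card J < card I" using room by (simp add: J_def I_def)
  then obtain x where x: "\<exists>i\<in>I. x i \<noteq> 0" "\<And>j. j \<in> J \<Longrightarrow> (\<Sum>i\<in>I. c j i * x i) = 0"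
    using exists_nontrivial_solution[of J I c] by (auto simp: J_def I_def)
  define P where "P r = (\<Sum>i<a. smult (x (r, i)) (monom 1 i))" for r
  have coeff_P: "coeff (P r) i = x (r, i)" if "i < a" for r i
    using that by (simp add: P_def coeff_sum if_distrib[where f="\<lambda>t. _ * t"] cong: if_cong)
  have "a > 0" using room by (cases a) auto
  then have deg_P: "degree (P r) \<le> a - 1" for r
    unfolding P_def by (intro degree_sum_le) (auto intro: order.trans[OF degree_smult_le] simp: degree_monom_eq)

  define R where "R = (\<Sum>r<n. \<Psi> r * P r)"
  have \<delta>_R: "(\<delta> ^^ j) R = (\<Sum>r<n. \<Psi> r * (T r ^^ j) (P r))" for j
  proof (induction j)
    case (Suc j)
    have "\<delta> (\<Sum>r<n. \<Psi> r * (T r ^^ j) (P r)) = (\<Sum>r<n. D * pderiv (\<Psi> r * (T r ^^ j) (P r)))"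
      by (simp add: \<delta>_def pderiv_sum sum_distrib_left)
    also have "\<dots> = (\<Sum>r<n. \<Psi> r * (T r ^^ Suc j) (P r))"
    proof (rule sum.cong)
      fix r assume "r \<in> {..<n}"
      then have "D * pderiv (\<Psi> r) = g r * \<Psi> r" using deriv by simp
      then have "D * (pderiv (\<Psi> r) * Q) = \<Psi> r * (g r * Q)" for Q
        by (metis mult.assoc mult.commute)
      then show "D * pderiv (\<Psi> r * (T r ^^ j) (P r)) = \<Psi> r * (T r ^^ Suc j) (P r)"
        by (simp add: pderiv_mult T_def algebra_simps)
    qed simp
    finally show ?case using Suc by simp
  qed (simp add: R_def)

  have C0: "(\<Sum>r<n. (T r ^^ j) (P r) * \<mu> r) = 0" if "j < M" for j
  proof (rule poly_eqI)
    fix m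
    show "coeff (\<Sum>r<n. (T r ^^ j) (P r) * \<mu> r) m = coeff 0 m"
    proof (cases "m < a + d + s * j")
      case True
      with that have "(j, m) \<in> J" by (simp add: J_def)
      then have "0 = (\<Sum>i\<in>I. c (j, m) i * x i)" using x by simp
      also have "\<dots> = (\<Sum>r<n. \<Sum>i<a. c (j, m) (r, i) * x (r, i))"
        by (simp add: I_def sum.cartesian_product)
      also have "\<dots> = coeff (\<Sum>r<n. (T r ^^ j) (P r) * \<mu> r) m"
        by (simp add: c_def P_def T_sum T_smult coeff_sum sum_distrib_right mult.commute[of _ "x _"])
      finally show ?thesis by simp
    next
      case False
      have "coeff ((T r ^^ j) (P r) * \<mu> r) m = 0" if "r < n" for r
      proof (rule coeff_eq_0)
        have "degree ((T r ^^ j) (P r) * \<mu> r) \<le> degree ((T r ^^ j) (P r)) + degree (\<mu> r)"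
          by (rule degree_mult_le)
        also have "\<dots> \<le> (a - 1 + s * j) + d"
          using deg_T[OF that, of j "P r"] deg_P[of r] deg\<mu>[OF that] by linarith
        also have "\<dots> < m" using False \<open>a > 0\<close> by linarith
        finally show "degree ((T r ^^ j) (P r) * \<mu> r) < m" .
      qed
      then show ?thesis by (simp add: coeff_sum)
    qed
  qed

  have R_0: "poly ((\<delta> ^^ j) R) z = 0" if "j < M" "z \<in> Z" for j z
  proof -
    have "poly ((\<delta> ^^ j) R) z = poly (\<Sum>r<n. (T r ^^ j) (P r) * \<mu> r) z"
      using that val by (simp add: \<delta>_R poly_sum mult.commute)
    then show ?thesis using C0 that by simp
  qed

  have "R \<noteq> 0"
  proof -
    define Y where "Y = {r. r < n \<and> P r \<noteq> 0}"
    have "R = (\<Sum>r\<in>Y. \<Psi> r * P r)"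
      unfolding R_def Y_def by (intro sum.mono_neutral_right) auto
    moreover have "(\<Sum>r\<in>Y. \<Psi> r * P r) \<noteq> 0"
    proof (rule sum_nonzero_of_distinct_orders)
      obtain r i where ri: "r < n" "i < a" "x (r, i) \<noteq> 0" using x(1) by (auto simp: I_def)
      then have "P r \<noteq> 0" using coeff_P by (metis coeff_0)
      then show "Y \<noteq> {}" using ri by (auto simp: Y_def)
      show "finite Y" by (simp add: Y_def)
      have E_ne: "E r \<noteq> 0" if "r < n" for r using E0[OF that] by auto
      show ne: "\<Psi> r * P r \<noteq> 0" if "r \<in> Y" for r
        using that \<Psi>[of r] E_ne[of r] by (auto simp: Y_def)
      have ord: "order \<theta> (\<Psi> r * P r) = k r + order \<theta> (P r)" if "r \<in> Y" for r
      proof -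
        have "order \<theta> (E r) = 0" using E0 that by (intro order_0I) (auto simp: Y_def)
        then show ?thesis using ne[OF that] that \<Psi>[of r]
          by (auto simp: Y_def order_mult order_power_n_n)
      qed
      \<comment> \<open>This keeps the order of the summand in \<open>{k r..<k r + a}\<close>, and
        the gaps make these ranges disjoint.\<close>
      have ord_P: "order \<theta> (P r) < a" if "r \<in> Y" for r
        using that order_degree[of "P r" \<theta>] deg_P[of r] \<open>a > 0\<close> by (auto simp: Y_def)
      show "inj_on (\<lambda>r. order \<theta> (\<Psi> r * P r)) Y"
      proof (rule inj_onI, rule ccontr)
        fix r r' assume *: "r \<in> Y" "r' \<in> Y" "order \<theta> (\<Psi> r * P r) = order \<theta> (\<Psi> r' * P r')" "r \<noteq> r'"
        then show False using gap[of r r'] ord ord_P[of r] ord_P[of r'] by (auto simp: Y_def)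
      qed
    qed
    ultimately show ?thesis by simp
  qed
  then have "M \<le> order z R" if "z \<in> Z" for z
    using that D0 char R_0 by (intro multiple_root_of_derivation[of R D]) (auto simp: \<delta>_def)
  then have "M * card Z \<le> degree R" using fin \<open>R \<noteq> 0\<close> by (intro sum_order_le_degree)
  also have "degree R \<le> N + (a - 1)"
    unfolding R_def
  proof (rule degree_sum_le)
    fix r assume "r \<in> {..<n}"
    then show "degree (\<Psi> r * P r) \<le> N + (a - 1)"
      using degree_mult_le[of "\<Psi> r" "P r"] deg\<Psi>[of r] deg_P[of r] by simp
  qed simp
  finally show ?thesis using \<open>a > 0\<close> by linarith
qed

section \<open>Stepanov's bound for cubic residue classes of products of four linear factors\<close>

lemma log_deriv_power:
  "[:-c, 1:] * pderiv ([:-c, 1:] ^ n) = smult (of_nat n) ([:-c, 1:] ^ n)" for c :: "'b::field"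
proof (cases n)
  case (Suc k)
  have "pderiv [:-c, 1:] = 1" by (simp add: pderiv_pCons)
  then show ?thesis unfolding Suc pderiv_power_Suc
    by (simp only: mult_1_right mult_smult_right power_Suc)
qed simp

lemma degree_prod4_linear_powers:
  "degree ([:-c1, 1:] ^ n1 * [:-c2, 1:] ^ n2 * [:-c3, 1:] ^ n3 * [:-c4, 1:] ^ n4)
     = n1 + n2 + n3 + n4" for c1 :: "'b::field"
  by (simp add: degree_mult_eq degree_linear_power)

text \<open>The five functions are \<open>1\<close>, the powers of \<open>z - c1\<close> with
  exponents \<open>q\<close> and \<open>2 * q\<close>, and two products of \<open>e\<close>-th
  powers; on \<open>Z\<close> all agree with polynomials of degree at most \<open>4\<close>. Their
  orders at \<open>c1\<close> are \<open>0\<close>, \<open>e\<close>, \<open>2 * e\<close>,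
  \<open>q\<close> and \<open>2 * q\<close> in some arrangement, hence well separated.\<close>

lemma stepanov_cubic_class:
  fixes c1 c2 c3 c4 :: "'b::field" and \<pi> \<rho> :: "'b poly"
  assumes c: "c1 \<noteq> c2" "c1 \<noteq> c3" "c1 \<noteq> c4"
    and m1: "m1 = 1 \<and> n1 = 2 \<or> m1 = 2 \<and> n1 = 1"
    and m: "m1 + m2 + m3 + m4 \<le> 6" and n: "n1 + n2 + n3 + n4 \<le> (6::nat)"
    and p: "prime CHAR('b)" "CHAR('b) > 3" "q = CHAR('b) ^ h"
    and e: "35 \<le> e" "2 * e + 35 \<le> q" "6 * e \<le> 2 * q + 2"
    and deg: "degree \<pi> \<le> 4" "degree \<rho> \<le> 4" and fin: "finite Z"
    and Z: "\<And>z. z \<in> Z \<Longrightarrow> z ^ q = z \<and> z \<noteq> c1 \<and> z \<noteq> c2 \<and> z \<noteq> c3 \<and> z \<noteq> c4"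
    and Z\<pi>: "\<And>z. z \<in> Z \<Longrightarrow> (z - c1) ^ (m1 * e) * (z - c2) ^ (m2 * e) * (z - c3) ^ (m3 * e)
                 * (z - c4) ^ (m4 * e) = poly \<pi> z"
    and Z\<rho>: "\<And>z. z \<in> Z \<Longrightarrow> (z - c1) ^ (n1 * e) * (z - c2) ^ (n2 * e) * (z - c3) ^ (n3 * e)
                 * (z - c4) ^ (n4 * e) = poly \<rho> z"
  shows "4 * card Z \<le> 2 * q + 36"
proof -
  define l where "l c = [:-c, 1:]" for c :: 'b
  define D where "D = l c1 * l c2 * l c3 * l c4"
  define G where "G i1 i2 i3 i4 = smult (of_nat i1) (l c2 * l c3 * l c4) + smult (of_nat i2) (l c1 * l c3 * l c4)
     + smult (of_nat i3) (l c1 * l c2 * l c4) + smult (of_nat i4) (l c1 * l c2 * l c3)" for i1 i2 i3 i4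
  define Y where "Y i1 i2 i3 i4 = l c1 ^ i1 * l c2 ^ i2 * l c3 ^ i3 * l c4 ^ i4" for i1 i2 i3 i4
  \<comment> \<open>Rewriting with this equation splits a premise of Stepanov's method into one
    concrete claim per list entry.\<close>
  have five: "(\<And>r. r < 5 \<Longrightarrow> Q r) \<equiv> Trueprop (Q 0 \<and> Q 1 \<and> Q 2 \<and> Q 3 \<and> Q (4::nat))" for Q
  proof (rule equal_intr_rule)
    assume "Q 0 \<and> Q 1 \<and> Q 2 \<and> Q 3 \<and> Q 4"
    moreover fix r :: nat assume "r < 5"
    then have "r = 0 \<or> r = 1 \<or> r = 2 \<or> r = 3 \<or> r = 4" by auto
    ultimately show "Q r" by auto
  qed simp
  have ld: "l c * pderiv (l c ^ i) = smult (of_nat i) (l c ^ i)" for c i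
    unfolding l_def by (rule log_deriv_power)
  have DY: "D * pderiv (Y i1 i2 i3 i4) = G i1 i2 i3 i4 * Y i1 i2 i3 i4" for i1 i2 i3 i4
  proof -
    have "D * pderiv (Y i1 i2 i3 i4) =
        (l c1 * pderiv (l c1 ^ i1)) * l c2 * l c3 * l c4 * (l c2 ^ i2 * l c3 ^ i3 * l c4 ^ i4)
      + (l c2 * pderiv (l c2 ^ i2)) * l c1 * l c3 * l c4 * (l c1 ^ i1 * l c3 ^ i3 * l c4 ^ i4)
      + (l c3 * pderiv (l c3 ^ i3)) * l c1 * l c2 * l c4 * (l c1 ^ i1 * l c2 ^ i2 * l c4 ^ i4)
      + (l c4 * pderiv (l c4 ^ i4)) * l c1 * l c2 * l c3 * (l c1 ^ i1 * l c2 ^ i2 * l c3 ^ i3)"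
      unfolding D_def Y_def pderiv_mult by (simp add: algebra_simps)
    then show ?thesis unfolding ld G_def Y_def by (simp add: algebra_simps)
  qed
  have degD: "degree D \<le> Suc 3"
    using degree_prod4_linear_powers[of c1 1 c2 1 c3 1 c4 1] by (simp add: D_def l_def)
  have degG: "degree (G i1 i2 i3 i4) \<le> 3" for i1 i2 i3 i4
  proof -
    have "degree (l x * l y * l z) \<le> 3" for x y z :: 'b
      using degree_prod4_linear_powers[of x 1 y 1 z 1 z 0] by (simp add: l_def)
    then show ?thesis unfolding G_def
      by (intro degree_add_le order.trans[OF degree_smult_le])
  qed
  have degY: "degree (Y i1 i2 i3 i4) = i1 + i2 + i3 + i4" for i1 i2 i3 i4
    using degree_prod4_linear_powers by (simp add: Y_def l_def)
  have q: "q > 1" using e by linarith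
  then have "h > 0" using p(3) by (cases h) auto
  then have q0: "of_nat q = (0::'b)" using p(3) by (simp add: of_nat_CHAR)
  \<comment> \<open>Since \<open>z ^ q = z\<close>, the \<open>q\<close>-th power becomes linear on
    \<open>Z\<close> even if \<open>c1\<close> itself is not fixed.\<close>
  have frob: "(z - c1) ^ q = z - c1 ^ q" if "z \<in> Z" for z
  proof -
    have "(z - c1 + c1) ^ q = (z - c1) ^ q + c1 ^ q"
      unfolding p(3) by (rule freshmans_dream'[OF p(1)]) simp
    then show ?thesis using Z[OF that] by (simp add: algebra_simps)
  qed
  define \<Psi> where "\<Psi> r = [1, Y q 0 0 0, Y (2*q) 0 0 0, Y (m1*e) (m2*e) (m3*e) (m4*e), Y (n1*e) (n2*e) (n3*e) (n4*e)] ! r" for r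
  define g where "g r = [0, G q 0 0 0, G (2*q) 0 0 0, G (m1*e) (m2*e) (m3*e) (m4*e), G (n1*e) (n2*e) (n3*e) (n4*e)] ! r" for r
  define \<mu> where "\<mu> r = [1, l (c1 ^ q), l (c1 ^ q) ^ 2, \<pi>, \<rho>] ! r" for r
  define E where "E r = [1, 1, 1, l c2 ^ (m2*e) * l c3 ^ (m3*e) * l c4 ^ (m4*e), l c2 ^ (n2*e) * l c3 ^ (n3*e) * l c4 ^ (n4*e)] ! r" for r
  define k where "k r = [0, q, 2*q, m1*e, n1*e] ! r" for r
  \<comment> \<open>\<open>35\<close> is the least \<open>a\<close> with \<open>4 a + (4 + 7 + 10 + 13) < 5 a\<close>.\<close>
  have "4 * card Z < (2 * q + 2) + 35"
  proof (rule stepanov[where \<Psi> = \<Psi> and g = g and \<mu> = \<mu> and E = E and k = k and D = D and s = 3 and n = 5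
        and d = 4 and \<theta> = c1])
    show "finite Z" "degree D \<le> Suc 3" by fact+
    show "\<And>r. r < 5 \<Longrightarrow> degree (g r) \<le> 3"
      unfolding five g_def using degG by simp
    show "\<And>r. r < 5 \<Longrightarrow> D * pderiv (\<Psi> r) = g r * \<Psi> r"
      unfolding five g_def \<Psi>_def using DY by simp
    show "\<And>r. r < 5 \<Longrightarrow> degree (\<mu> r) \<le> 4"
      unfolding five \<mu>_def using deg by (simp add: l_def degree_linear_power)
    show "\<And>z. z \<in> Z \<Longrightarrow> poly D z \<noteq> 0" using Z unfolding D_def l_def poly_mult by simp
    show "of_nat j \<noteq> (0::'b)" if "0 < j" "j < 4" for j
      using that p(2) by (simp add: of_nat_eq_0_iff_char_dvd nat_dvd_not_less)
    show "poly (\<Psi> r) z = poly (\<mu> r) z" if "r < 5" "z \<in> Z" for r z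
    proof -
      have "\<And>r. r < 5 \<Longrightarrow> poly (\<Psi> r) z = poly (\<mu> r) z"
        unfolding five \<Psi>_def \<mu>_def Y_def l_def
        using Z\<pi>[OF that(2)] Z\<rho>[OF that(2)] frob[OF that(2)]
        by (simp add: power_mult mult.commute[of 2])
      then show ?thesis using that by blast
    qed
    show "\<And>r. r < 5 \<Longrightarrow> \<Psi> r = [:-c1, 1:] ^ k r * E r"
      unfolding five \<Psi>_def k_def E_def Y_def by (simp add: l_def mult.assoc)
    show "\<And>r. r < 5 \<Longrightarrow> poly (E r) c1 \<noteq> 0"
      unfolding five E_def using c by (simp add: l_def)
    show "k r + 35 \<le> k r' \<or> k r' + 35 \<le> k r" if "r < 5" "r' < 5" "r \<noteq> r'" for r r'
    proof -
      have "\<And>r. r < 5 \<Longrightarrow> (\<forall>r'<5. r \<noteq> r' \<longrightarrow> k r + 35 \<le> k r' \<or> k r' + 35 \<le> k r)"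
        unfolding five using m1 e(1,2)
        by (auto simp: k_def less_Suc_eq numeral_eq_Suc)
      then show ?thesis using that by blast
    qed
    show "\<And>r. r < 5 \<Longrightarrow> degree (\<Psi> r) \<le> 2 * q + 2"
    proof -
      have "m1 * e + m2 * e + m3 * e + m4 * e \<le> 2 * q + 2" "n1 * e + n2 * e + n3 * e + n4 * e \<le> 2 * q + 2"
        using mult_le_mono1[OF m, of e] mult_le_mono1[OF n, of e] e(3) by (simp_all add: algebra_simps)
      then show "\<And>r. r < 5 \<Longrightarrow> degree (\<Psi> r) \<le> 2 * q + 2"
        unfolding five \<Psi>_def using degY by simp
    qed
    show "(\<Sum>j<4. 35 + 4 + 3 * j) < 5 * (35::nat)" by (simp add: eval_nat_numeral)
  qed
  then show ?thesis by simp
qed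

section \<open>The permutation criterion\<close>

lemma cube_root_of_unity:
  fixes w :: "'b::field"
  assumes "w ^ 2 + w + 1 = 0" "u ^ 3 = 1"
  shows "u = 1 \<or> u = w \<or> u = w ^ 2"
proof -
  have "(u - 1) * (u - w) * (u - w ^ 2) = 0" using assms by Groebner_Basis.algebra
  then show ?thesis by auto
qed

text \<open>The inequalities exclude degenerate points: \<open>A0\<close> and \<open>B2\<close> keep
  the factors of \<open>H(B)\<close> nonzero, \<open>B1\<close> serves the lines \<open>n1\<close>,
  \<open>n2\<close>, \<open>d1\<close>, \<open>d2\<close>, and \<open>B0\<close> the coefficients
  \<open>p0\<close>, \<open>p1\<close>, \<open>p2\<close>.\<close>

locale split_form =
  fixes w A B t :: "'b::field" and q :: nat
  assumes w: "w ^ 2 + w + 1 = 0" and three: "(3::'b) \<noteq> 0"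
    and frob_add: "\<And>x y :: 'b. (x + y) ^ q = x ^ q + y ^ q"
    and Aq: "A ^ q = A" and Bq: "B ^ q = B"
    and curve: "A ^ 3 + B ^ 2 - B + 1 = 0"
    and A0: "A \<noteq> 0" and B0: "B \<noteq> 0" and B1: "B \<noteq> 1" and B2: "B ^ 2 + 2 * B + 4 \<noteq> 0"
    and t: "t ^ 3 = (B + w ^ 2) * (B - 2 * w) / ((B + w) * (B - 2 * w ^ 2))"
begin

lemma factors_nonzero: "B + w \<noteq> 0" "B + w ^ 2 \<noteq> 0" "B - 2 * w \<noteq> 0" "B - 2 * w ^ 2 \<noteq> 0"
proof -
  have "A ^ 3 = - ((B + w) * (B + w ^ 2))" using curve w by Groebner_Basis.algebra
  then show "B + w \<noteq> 0" "B + w ^ 2 \<noteq> 0" using A0 by auto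
  have "B ^ 2 + 2 * B + 4 = (B - 2 * w) * (B - 2 * w ^ 2)" using w by Groebner_Basis.algebra
  then show "B - 2 * w \<noteq> 0" "B - 2 * w ^ 2 \<noteq> 0" using B2 by auto
qed

lemma t_nonzero: "t \<noteq> 0"
  using t factors_nonzero by (metis divide_eq_0_iff no_zero_divisors zero_power zero_less_numeral)

text \<open>
  The factors \<open>r1\<close> and \<open>r2\<close> rescale the eigencoordinates \<open>a + w b + w\<^sup>2 c\<close> and \<open>a + w\<^sup>2 b + w c\<close> of the
  cyclic shift. The first two of the \<open>twist_relations\<close> below force
  \<open>r1\<^sup>3 = p2 (2 - B + 2 A) / (p0 (2 - B + 2 w\<^sup>2 A))\<close>; on the curve this function is \<open>H(B)\<close> times the
  cube of \<open>d1 / n1\<close>.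
\<close>

definition "n1 = B + w ^ 2 - w ^ 2 * A"
definition "n2 = B + w - w * A"
definition "d1 = B + w - A"
definition "d2 = B + w ^ 2 - A"
definition "r1 = t * d1 / n1"
definition "r2 = d2 / (t * n2)"

text \<open>Eliminating \<open>A\<close> shows that each line meets the curve only where
  \<open>B = 1\<close> or a factor of \<open>H(B)\<close> vanishes.\<close>

lemma lines_nonzero: "n1 \<noteq> 0" "n2 \<noteq> 0" "d1 \<noteq> 0" "d2 \<noteq> 0"
proof -
  have 1: "(B + w ^ 2) * (B - 1) * (B - 2 * w) \<noteq> 0" "(B + w) * (B - 1) * (B - 2 * w ^ 2) \<noteq> 0"
    using factors_nonzero B1 by auto
  show "n1 \<noteq> 0"
  proof
    assume "n1 = 0"
    then have "(B + w ^ 2) * (B - 1) * (B - 2 * w) = 0" using curve w unfolding n1_def by Groebner_Basis.algebra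
    with 1 show False by simp
  qed
  show "n2 \<noteq> 0"
  proof
    assume "n2 = 0"
    then have "(B + w) * (B - 1) * (B - 2 * w ^ 2) = 0" using curve w unfolding n2_def by Groebner_Basis.algebra
    with 1 show False by simp
  qed
  show "d1 \<noteq> 0"
  proof
    assume "d1 = 0"
    then have "(B + w) * (B - 1) * (B - 2 * w ^ 2) = 0" using curve w unfolding d1_def by Groebner_Basis.algebra
    with 1 show False by simp
  qed
  show "d2 \<noteq> 0"
  proof
    assume "d2 = 0"
    then have "(B + w ^ 2) * (B - 1) * (B - 2 * w) = 0" using curve w unfolding d2_def by Groebner_Basis.algebra
    with 1 show False by simp
  qed
qed

lemma r_nonzero: "r1 \<noteq> 0" "r2 \<noteq> 0"
  using lines_nonzero t_nonzero by (simp_all add: r1_def r2_def)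

text \<open>Weighted by cube roots of unity, three times the sum of the cyclic shifts of
  \<open>Q\<close> contains one square and one product of eigencoordinates. These are the
  coefficients of the squares.\<close>

definition "p0 = 1 + B + A"
definition "p1 = 1 + B + w * A"
definition "p2 = 1 + B + w ^ 2 * A"

text \<open>The product is \<open>(1 + B) ^ 3 + A ^ 3\<close>, which on the curve becomes a
  polynomial in \<open>B\<close> alone.\<close>

lemma p_nonzero: "p0 \<noteq> 0" "p1 \<noteq> 0" "p2 \<noteq> 0"
proof -
  have "p0 * p1 * p2 = B * (B ^ 2 + 2 * B + 4)"
    unfolding p0_def p1_def p2_def using curve w by Groebner_Basis.algebra
  then show "p0 \<noteq> 0" "p1 \<noteq> 0" "p2 \<noteq> 0" using B0 B2 by auto
qed

text \<open>After rescaling, the product in each transformed form has minus the coefficient of the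
  square. In the first relation \<open>t\<close> cancels and the curve equation suffices; the other
  two also need \<open>t ^ 3 = H(B)\<close>.\<close>

lemma twist_relations:
  "2 - B + 2 * A = - p0 * r1 * r2"
  "(2 - B + 2 * w ^ 2 * A) * r1 ^ 2 = - p2 * r2"
  "(2 - B + 2 * w * A) * r2 ^ 2 = - p1 * r1"
proof -
  note nz = lines_nonzero t_nonzero factors_nonzero
  have "d1 * d2 * p0 + (2 - B + 2 * A) * n1 * n2 = 0"
    unfolding d1_def d2_def n1_def n2_def p0_def using curve w by Groebner_Basis.algebra
  moreover have "r1 * r2 = d1 * d2 / (n1 * n2)" using nz by (simp add: r1_def r2_def)
  ultimately show "2 - B + 2 * A = - p0 * r1 * r2"
    using nz by (simp add: mult.assoc) (simp add: field_simps add_eq_0_iff)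
  have t3: "t ^ 3 * ((B + w) * (B - 2 * w ^ 2)) = (B + w ^ 2) * (B - 2 * w)"
    using t nz by simp
  have e1: "(B + w ^ 2) * (B - 2 * w) * ((2 - B + 2 * w ^ 2 * A) * d1 ^ 2 * n2)
      + p2 * d2 * n1 ^ 2 * ((B + w) * (B - 2 * w ^ 2)) = 0"
    unfolding d1_def d2_def n1_def n2_def p2_def using curve w by Groebner_Basis.algebra
  have "((B + w) * (B - 2 * w ^ 2)) * (t ^ 3 * (2 - B + 2 * w ^ 2 * A) * d1 ^ 2 * n2 + p2 * d2 * n1 ^ 2) = 0"
    using e1 unfolding t3[symmetric] by (simp add: algebra_simps)
  then have "t ^ 3 * (2 - B + 2 * w ^ 2 * A) * d1 ^ 2 * n2 = - p2 * d2 * n1 ^ 2"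
    using nz by (simp add: eq_neg_iff_add_eq_0)
  then show "(2 - B + 2 * w ^ 2 * A) * r1 ^ 2 = - p2 * r2"
    using nz by (simp add: r1_def r2_def divide_simps) (simp add: algebra_simps power2_eq_square power3_eq_cube)
  have e2: "((2 - B + 2 * w * A) * d2 ^ 2 * n1) * ((B + w) * (B - 2 * w ^ 2))
      + p1 * d1 * n2 ^ 2 * ((B + w ^ 2) * (B - 2 * w)) = 0"
    unfolding d1_def d2_def n1_def n2_def p1_def using curve w by Groebner_Basis.algebra
  have "((B + w) * (B - 2 * w ^ 2)) * ((2 - B + 2 * w * A) * d2 ^ 2 * n1 + t ^ 3 * p1 * d1 * n2 ^ 2) = 0"
    using e2 unfolding t3[symmetric] by (simp add: algebra_simps)
  then have "(2 - B + 2 * w * A) * d2 ^ 2 * n1 = - (t ^ 3 * p1 * d1 * n2 ^ 2)"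
    using nz by (simp add: eq_neg_iff_add_eq_0)
  then show "(2 - B + 2 * w * A) * r2 ^ 2 = - p1 * r1"
    using nz by (simp add: r1_def r2_def divide_simps) (simp add: algebra_simps power2_eq_square power3_eq_cube)
qed

text \<open>The \<open>v\<close> are the discrete Fourier transform of \<open>a\<close>,
  \<open>b\<close>, \<open>c\<close> with two components rescaled, and the \<open>y\<close>
  transform back: for \<open>r1 = r2 = 1\<close> they would be \<open>3 * a\<close>,
  \<open>3 * c\<close>, \<open>3 * b\<close>.\<close>

definition "Q a b c = a ^ 2 + A * c ^ 2 + B * b * c"
definition "v0 a b c = a + b + c"
definition "v1 a b c = r1 * (a + w * b + w ^ 2 * c)"
definition "v2 a b c = r2 * (a + w ^ 2 * b + w * c)"
definition "y0 a b c = v0 a b c + v1 a b c + v2 a b c"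
definition "y1 a b c = v0 a b c + w * v1 a b c + w ^ 2 * v2 a b c"
definition "y2 a b c = v0 a b c + w ^ 2 * v1 a b c + w * v2 a b c"

text \<open>In eigencoordinates each weighted sum of the shifts of \<open>Q\<close> has one square
  and one product, whose coefficients the twist relations balance.\<close>

lemma v_forms:
  "p0 * (v0 a b c ^ 2 - v1 a b c * v2 a b c) = 3 * (Q a b c + Q b c a + Q c a b)"
  "p2 * (v1 a b c ^ 2 - v0 a b c * v2 a b c) = 3 * r1 ^ 2 * (Q a b c + w ^ 2 * Q b c a + w * Q c a b)"
  "p1 * (v2 a b c ^ 2 - v0 a b c * v1 a b c) = 3 * r2 ^ 2 * (Q a b c + w * Q b c a + w ^ 2 * Q c a b)"
proof -
  define u0 u1 u2 where u: "u0 = a + b + c" "u1 = a + w * b + w ^ 2 * c" "u2 = a + w ^ 2 * b + w * c"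
  note v = v0_def v1_def v2_def u[symmetric]
  have "p0 * (u0 ^ 2 - r1 * u1 * (r2 * u2)) = p0 * u0 ^ 2 + (- p0 * r1 * r2) * (u1 * u2)"
    by (simp add: algebra_simps)
  also have "\<dots> = p0 * u0 ^ 2 + (2 - B + 2 * A) * (u1 * u2)" by (simp add: twist_relations(1))
  also have "\<dots> = 3 * (Q a b c + Q b c a + Q c a b)"
    unfolding u p0_def Q_def using w by Groebner_Basis.algebra
  finally show "p0 * (v0 a b c ^ 2 - v1 a b c * v2 a b c) = 3 * (Q a b c + Q b c a + Q c a b)"
    by (simp add: v)
  have "p2 * ((r1 * u1) ^ 2 - u0 * (r2 * u2)) = r1 ^ 2 * p2 * u1 ^ 2 + (- p2 * r2) * (u0 * u2)"
    by (simp add: algebra_simps)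
  also have "\<dots> = r1 ^ 2 * (p2 * u1 ^ 2 + (2 - B + 2 * w ^ 2 * A) * (u0 * u2))"
    unfolding twist_relations(2)[symmetric] by (simp add: algebra_simps)
  also have "p2 * u1 ^ 2 + (2 - B + 2 * w ^ 2 * A) * (u0 * u2) = 3 * (Q a b c + w ^ 2 * Q b c a + w * Q c a b)"
    unfolding u p2_def Q_def using w by Groebner_Basis.algebra
  finally show "p2 * (v1 a b c ^ 2 - v0 a b c * v2 a b c) = 3 * r1 ^ 2 * (Q a b c + w ^ 2 * Q b c a + w * Q c a b)"
    unfolding v by (simp only: mult.assoc mult.left_commute)
  have "p1 * ((r2 * u2) ^ 2 - u0 * (r1 * u1)) = r2 ^ 2 * p1 * u2 ^ 2 + (- p1 * r1) * (u0 * u1)"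
    by (simp add: algebra_simps)
  also have "\<dots> = r2 ^ 2 * (p1 * u2 ^ 2 + (2 - B + 2 * w * A) * (u0 * u1))"
    unfolding twist_relations(3)[symmetric] by (simp add: algebra_simps)
  also have "p1 * u2 ^ 2 + (2 - B + 2 * w * A) * (u0 * u1) = 3 * (Q a b c + w * Q b c a + w ^ 2 * Q c a b)"
    unfolding u p1_def Q_def using w by Groebner_Basis.algebra
  finally show "p1 * (v2 a b c ^ 2 - v0 a b c * v1 a b c) = 3 * r2 ^ 2 * (Q a b c + w * Q b c a + w ^ 2 * Q c a b)"
    unfolding v by (simp only: mult.assoc mult.left_commute)
qed

text \<open>The products of two lines are combinations of \<open>F0\<close>, \<open>F1\<close>,
  \<open>F2\<close>, which by \<open>v_forms\<close> depend linearly on the three values of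
  \<open>Q\<close>.\<close>

lemma y_products:
  assumes "Q a b c = l * Q a' b' c'" "Q b c a = l * Q b' c' a'" "Q c a b = l * Q c' a' b'"
  shows "y0 a b c * y1 a b c = l * (y0 a' b' c' * y1 a' b' c')"
    and "y1 a b c * y2 a b c = l * (y1 a' b' c' * y2 a' b' c')"
    and "y2 a b c * y0 a b c = l * (y2 a' b' c' * y0 a' b' c')"
proof -
  define F0 F1 F2 where F: "F0 a b c = v0 a b c ^ 2 - v1 a b c * v2 a b c"
    "F1 a b c = v1 a b c ^ 2 - v0 a b c * v2 a b c"
    "F2 a b c = v2 a b c ^ 2 - v0 a b c * v1 a b c" for a b c
  have "p0 * F0 a b c = p0 * (l * F0 a' b' c')" "p2 * F1 a b c = p2 * (l * F1 a' b' c')"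
       "p1 * F2 a b c = p1 * (l * F2 a' b' c')"
    unfolding mult.left_commute[of _ l] F v_forms assms by (simp_all add: algebra_simps)
  then have F': "F0 a b c = l * F0 a' b' c'" "F1 a b c = l * F1 a' b' c'" "F2 a b c = l * F2 a' b' c'"
    using p_nonzero by simp_all
  have *: "y0 a b c * y1 a b c = F0 a b c + w * F1 a b c + w ^ 2 * F2 a b c"
    "y1 a b c * y2 a b c = F0 a b c + F1 a b c + F2 a b c"
    "y2 a b c * y0 a b c = F0 a b c + w ^ 2 * F1 a b c + w * F2 a b c" for a b c
    unfolding y0_def y1_def y2_def F using w by Groebner_Basis.algebra+
  show "y0 a b c * y1 a b c = l * (y0 a' b' c' * y1 a' b' c')"
    "y1 a b c * y2 a b c = l * (y1 a' b' c' * y2 a' b' c')"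
    "y2 a b c * y0 a b c = l * (y2 a' b' c' * y0 a' b' c')"
    unfolding * F' by (simp_all add: algebra_simps)
qed

text \<open>Both transforms are invertible because \<open>3\<close>, \<open>r1\<close> and
  \<open>r2\<close> are nonzero. The first coordinate is enough, as Frobenius carries it to the
  other two.\<close>

lemma coords_of_lines:
  assumes "y0 a b c = r * y0 a' b' c'" "y1 a b c = r * y1 a' b' c'" "y2 a b c = r * y2 a' b' c'"
  shows "a = r * a'"
proof -
  have v: "3 * v0 a b c = y0 a b c + y1 a b c + y2 a b c"
    "3 * v1 a b c = y0 a b c + w ^ 2 * y1 a b c + w * y2 a b c"
    "3 * v2 a b c = y0 a b c + w * y1 a b c + w ^ 2 * y2 a b c" for a b c
    unfolding y0_def y1_def y2_def using w by Groebner_Basis.algebra+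
  have "3 * v0 a b c = 3 * (r * v0 a' b' c')" "3 * v1 a b c = 3 * (r * v1 a' b' c')"
       "3 * v2 a b c = 3 * (r * v2 a' b' c')"
    unfolding mult.left_commute[of 3 r] v assms by (simp_all add: algebra_simps)
  then have v': "v0 a b c = r * v0 a' b' c'" "v1 a b c = r * v1 a' b' c'" "v2 a b c = r * v2 a' b' c'"
    using three by simp_all
  have "3 * (r1 * r2) * a = r1 * r2 * v0 a b c + r2 * v1 a b c + r1 * v2 a b c" for a b c
    unfolding v0_def v1_def v2_def using w by Groebner_Basis.algebra
  note vs = this
  have "3 * (r1 * r2) * a = r * (r1 * r2 * v0 a' b' c' + r2 * v1 a' b' c' + r1 * v2 a' b' c')"
    unfolding vs[of a b c] v' by (simp add: algebra_simps)
  also have "\<dots> = 3 * (r1 * r2) * (r * a')"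
    unfolding vs[of a' b' c', symmetric] by (simp add: algebra_simps)
  finally have "3 * (r1 * r2) * a = 3 * (r1 * r2) * (r * a')" .
  then show ?thesis using three r_nonzero by simp
qed

section \<open>Injectivity when Frobenius cycles the three lines\<close>

definition "F x = x ^ (q ^ 2 + q - 1) + A * x ^ (q ^ 3 - q ^ 2 + q) + B * x"
definition "nrm x = x * x ^ q * x ^ q ^ 2"

lemma q_pos: "q > 0"
proof (rule ccontr)
  assume "\<not> q > 0"
  then have "(1::'b) + 1 = 1 + 0" using frob_add[of 0 0] by simp
  then show False by (simp only: add_left_cancel) simp
qed

lemma power_tower: "((x::'b) ^ q) ^ q = x ^ q ^ 2" "(x ^ q ^ 2) ^ q = x ^ q ^ 3"
  by (simp_all add: power2_eq_square power3_eq_cube mult_ac flip: power_mult)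

text \<open>With \<open>y\<close> and \<open>z\<close> the conjugates of \<open>x\<close>, the two
  powers are \<open>z * y / x\<close> and \<open>x * y / z\<close>; the norm
  \<open>x * y * z\<close> clears the denominators.\<close>

lemma nrm_times_F:
  assumes x: "x \<noteq> 0" "x ^ q ^ 3 = x"
  shows "nrm x * F x = Q (x ^ q * x ^ q ^ 2) (x ^ q ^ 2 * x) (x * x ^ q)"
proof -
  define y z where yz: "y = x ^ q" "z = x ^ q ^ 2"
  have nz: "y \<noteq> 0" "z \<noteq> 0" using x by (simp_all add: yz)
  have "x ^ (q ^ 2 + q - 1) * x = z * y"
    using q_pos by (simp add: yz flip: power_Suc2 power_add)
  then have 1: "x ^ (q ^ 2 + q - 1) = z * y / x" using x by (simp add: field_simps)
  have le: "q ^ 2 \<le> q ^ 3" using q_pos by (intro power_increasing) auto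
  have "x ^ (q ^ 3 - q ^ 2 + q) * z = x ^ (q ^ 3 + q)"
    unfolding yz power_add[symmetric] using le by (intro arg_cong[where f = "(^) x"]) simp
  also have "\<dots> = x * y" using x by (simp add: power_add yz)
  finally have 2: "x ^ (q ^ 3 - q ^ 2 + q) = x * y / z" using nz by (simp add: field_simps)
  show ?thesis unfolding F_def nrm_def 1 2 Q_def yz[symmetric]
    using x nz by (simp add: field_simps power2_eq_square)
qed

lemma frob_Q: "Q a b c ^ q = Q (a ^ q) (b ^ q) (c ^ q)"
  by (simp add: Q_def frob_add power_mult_distrib Aq Bq) (simp add: mult.commute flip: power_mult)

lemma frob_cycle:
  fixes x :: 'b
  assumes "x ^ q ^ 3 = x"
  shows "(x ^ q * x ^ q ^ 2) ^ q = x ^ q ^ 2 * x" "(x ^ q ^ 2 * x) ^ q = x * x ^ q" "(x * x ^ q) ^ q = x ^ q * x ^ q ^ 2"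
  unfolding power_mult_distrib power_tower assms by (simp_all add: mult.commute)

definition cyclic :: "'b \<Rightarrow> 'b \<Rightarrow> 'b \<Rightarrow> bool" where
  "cyclic a b c \<longleftrightarrow> a ^ q = b \<and> b ^ q = c \<and> c ^ q = a"

text \<open>A cycle in either direction serves: it makes a zero of one line at a triple of
  conjugates a zero of all three.\<close>

definition good_form :: bool where
  "good_form \<longleftrightarrow> (\<forall>a b c. cyclic a b c \<longrightarrow> cyclic (y0 a b c) (y1 a b c) (y2 a b c)) \<or>
     (\<forall>a b c. cyclic a b c \<longrightarrow> cyclic (y0 a b c) (y2 a b c) (y1 a b c))"

lemma cyclic_nonzero:
  assumes "cyclic a b c" "a \<noteq> 0 \<or> b \<noteq> 0 \<or> c \<noteq> 0"
  shows "a \<noteq> 0 \<and> b \<noteq> 0 \<and> c \<noteq> 0"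
  using assms q_pos by (auto simp: cyclic_def)

lemma lines_nonvanishing:
  assumes "good_form" "cyclic a b c" "a \<noteq> 0"
  shows "y0 a b c \<noteq> 0 \<and> y1 a b c \<noteq> 0 \<and> y2 a b c \<noteq> 0"
proof -
  have "\<not> (y0 a b c = 0 \<and> y1 a b c = 0 \<and> y2 a b c = 0)"
    using coords_of_lines[of a b c 0 a b c] assms(3) by auto
  then show ?thesis
    using assms(1,2) cyclic_nonzero[of "y0 a b c"] unfolding good_form_def by blast
qed

text \<open>The three ratios of \<open>x0\<close>, \<open>x1\<close>, \<open>x2\<close> to
  \<open>z0\<close>, \<open>z1\<close>, \<open>z2\<close> have pairwise products \<open>l\<close>,
  so they coincide, and the Frobenius cycle fixes the common ratio.\<close>

lemma proportional:
  assumes cyc: "cyclic x0 x1 x2 \<and> cyclic z0 z1 z2 \<or> cyclic x0 x2 x1 \<and> cyclic z0 z2 z1"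
    and x0: "x0 \<noteq> 0" "x1 \<noteq> 0" "x2 \<noteq> 0" and z0: "z0 \<noteq> 0" "z1 \<noteq> 0" "z2 \<noteq> 0"
    and l: "x0 * x1 = l * (z0 * z1)" "x1 * x2 = l * (z1 * z2)" "x2 * x0 = l * (z2 * z0)"
  shows "\<exists>r. r ^ q = r \<and> r ^ 2 = l \<and> r \<noteq> 0 \<and> x0 = r * z0 \<and> x1 = r * z1 \<and> x2 = r * z2"
proof -
  define s0 s1 s2 where s: "s0 = x0 / z0" "s1 = x1 / z1" "s2 = x2 / z2"
  have nz: "s0 \<noteq> 0" "s1 \<noteq> 0" "s2 \<noteq> 0" using x0 z0 by (simp_all add: s)
  have ss: "s0 * s1 = l" "s1 * s2 = l" "s2 * s0 = l"
    using l z0 by (simp_all add: s)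
  then have "s0 * s1 = s2 * s1" "s1 * s0 = s2 * s0" by (simp_all add: mult.commute)
  then have eq: "s2 = s0" "s1 = s0" using nz by (auto simp: mult.commute)
  have "s0 ^ q = s0" using cyc eq by (auto simp: s power_divide cyclic_def)
  moreover have "s0 ^ 2 = l" using ss(1) eq by (simp add: power2_eq_square)
  ultimately show ?thesis using s eq nz z0 x0
    by (intro exI[of _ s0]) (metis nonzero_eq_divide_eq)
qed

text \<open>Equal values make the triples of \<open>Q\<close> proportional by
  \<open>l = nrm x / nrm x'\<close>, hence the lines proportional by some \<open>r\<close> with
  \<open>r ^ 2 = l\<close>. Then \<open>a\<close>, \<open>b\<close>, \<open>c\<close> scale by
  \<open>r\<close>, and \<open>nrm x = r ^ 2 * nrm x'\<close> together with
  \<open>nrm x ^ 2 = a x * b x * c x\<close> forces \<open>r = 1\<close>.\<close>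

lemma F_injective:
  assumes good: "good_form" and x: "x ^ q ^ 3 = x" and x': "x' ^ q ^ 3 = x'" and FF: "F x = F x'"
  shows "x = x'"
proof -
  define a b c where abc: "a x = x ^ q * x ^ q ^ 2" "b x = x ^ q ^ 2 * x" "c x = x * x ^ q" for x :: 'b
  have cyc: "cyclic (a x) (b x) (c x)" if "x ^ q ^ 3 = x" for x
    using frob_cycle[OF that] by (simp add: cyclic_def abc)
  have nz: "nrm x \<noteq> 0" "a x \<noteq> 0" if "x \<noteq> 0" for x
    using that by (simp_all add: nrm_def abc)
  have cycQ: "Q (b x) (c x) (a x) = l * Q (b x') (c x') (a x')" "Q (c x) (a x) (b x) = l * Q (c x') (a x') (b x')"
    if "Q (a x) (b x) (c x) = l * Q (a x') (b x') (c x')" "l ^ q = l" "x ^ q ^ 3 = x" "x' ^ q ^ 3 = x'" for l x x'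
  proof -
    have step: "Q (a1 ^ q) (b1 ^ q) (c1 ^ q) = l * Q (a2 ^ q) (b2 ^ q) (c2 ^ q)"
      if "Q a1 b1 c1 = l * Q a2 b2 c2" for a1 b1 c1 a2 b2 c2
      using arg_cong[OF that, where f = "\<lambda>u. u ^ q"] \<open>l ^ q = l\<close> by (simp add: frob_Q power_mult_distrib)
    show 1: "Q (b x) (c x) (a x) = l * Q (b x') (c x') (a x')"
      using step[OF that(1)] cyc[OF that(3)] cyc[OF that(4)] by (simp add: cyclic_def)
    show "Q (c x) (a x) (b x) = l * Q (c x') (a x') (b x')"
      using step[OF 1] cyc[OF that(3)] cyc[OF that(4)] by (simp add: cyclic_def)
  qed
  have nF: "nrm x * F x = Q (a x) (b x) (c x)" if "x \<noteq> 0" "x ^ q ^ 3 = x" for x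
    using nrm_times_F[OF that] by (simp add: abc)
  have F0: "F x \<noteq> 0" if "x \<noteq> 0" "x ^ q ^ 3 = x" for x
  proof
    assume "F x = 0"
    \<comment> \<open>Comparing the triple with itself at \<open>l = 0\<close> turns
      \<open>y_products\<close> into the vanishing of a product of two lines.\<close>
    then have "Q (a x) (b x) (c x) = 0 * Q (a x) (b x) (c x)" using nF[OF that] by simp
    moreover have "(0::'b) ^ q = 0" using q_pos by simp
    ultimately have "y0 (a x) (b x) (c x) * y1 (a x) (b x) (c x) = 0"
      using y_products(1)[of "a x" "b x" "c x" 0 "a x" "b x" "c x"] cycQ[of x 0 x] that by simp
    then show False using lines_nonvanishing[OF good cyc[OF that(2)] nz(2)[OF that(1)]] by simp
  qed
  have "q ^ 2 + q - 1 > 0" using q_pos by (cases q) auto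
  then have "F 0 = 0" using q_pos by (simp add: F_def power_0_left)
  show ?thesis
  proof (cases "x = 0 \<or> x' = 0")
    case True
    then show ?thesis using F0[of x] F0[of x'] x x' FF \<open>F 0 = 0\<close> by metis
  next
    case False
    then have xnz: "x \<noteq> 0" "x' \<noteq> 0" by auto
    define l where "l = nrm x / nrm x'"
    have "nrm z ^ q = nrm z" if "z ^ q ^ 3 = z" for z :: 'b
      unfolding nrm_def power_mult_distrib power_tower that by (simp add: mult_ac)
    then have lq: "l ^ q = l" using x x' by (simp add: l_def power_divide)
    have "Q (a x) (b x) (c x) = l * Q (a x') (b x') (c x')"
      unfolding nF[OF xnz(1) x, symmetric] nF[OF xnz(2) x', symmetric] FF l_def
      using nz xnz by simp
    note Qs = this cycQ[OF this lq x x']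
    have cycs: "cyclic (a x) (b x) (c x)" "cyclic (a x') (b x') (c x')"
      using cyc x x' by auto
    obtain r where r: "r ^ q = r" "r ^ 2 = l" "r \<noteq> 0"
      "y0 (a x) (b x) (c x) = r * y0 (a x') (b x') (c x')"
      "y1 (a x) (b x) (c x) = r * y1 (a x') (b x') (c x')"
      "y2 (a x) (b x) (c x) = r * y2 (a x') (b x') (c x')"
      using proportional[of "y0 (a x) (b x) (c x)" "y1 (a x) (b x) (c x)" "y2 (a x) (b x) (c x)"
          "y0 (a x') (b x') (c x')" "y1 (a x') (b x') (c x')" "y2 (a x') (b x') (c x')" l]
        y_products[OF Qs] lines_nonvanishing[OF good cycs(1) nz(2)[OF xnz(1)]]
        lines_nonvanishing[OF good cycs(2) nz(2)[OF xnz(2)]] good cycs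
      unfolding good_form_def by blast
    have ar: "a x = r * a x'" using coords_of_lines[OF r(4-6)] .
    then have br: "b x = r * b x'" using cycs r(1) by (auto simp: cyclic_def power_mult_distrib)
    then have cr: "c x = r * c x'" using cycs r(1) by (auto simp: cyclic_def power_mult_distrib)
    have n2: "nrm z ^ 2 = a z * b z * c z" for z
      by (simp add: nrm_def abc power2_eq_square)
    have na: "nrm z = a z * z" for z by (simp add: nrm_def abc)
    have nl: "nrm x = r ^ 2 * nrm x'" using nz(1)[OF xnz(2)] by (simp add: l_def r(2))
    have "r ^ 4 * nrm x' ^ 2 = nrm x ^ 2" unfolding nl by (simp add: power_mult_distrib flip: power_mult)
    also have "\<dots> = r ^ 3 * nrm x' ^ 2"
      unfolding n2 ar br cr by (simp add: power3_eq_cube)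
    finally have "r ^ 4 = r ^ 3" using nz(1)[OF xnz(2)] by simp
    then have "r ^ 3 * r = r ^ 3 * 1" by (simp add: power_Suc2[symmetric] eval_nat_numeral)
    then have "r = 1" using r(3) by simp
    then show ?thesis using nl ar na[of x] na[of x'] nz[OF xnz(2)] by simp
  qed
qed

text \<open>Here \<open>\<tau> = t ^ (q - 1)\<close> is the \<open>e\<close>-th power of
  \<open>H(B)\<close>. On a triple of conjugates Frobenius fixes \<open>v0\<close>, multiplies
  \<open>v1\<close> by \<open>\<tau> * w ^ 2\<close> and \<open>v2\<close> by the inverse. The lines
  are thus fixed for \<open>\<tau> = w\<close> and cycled for the other two cube roots of
  unity.\<close>

lemma good_form_split:
  assumes wq: "w ^ q = w" and e: "q = 3 * e + 1"
    and t1: "((B + w ^ 2) * (B - 2 * w) / ((B + w) * (B - 2 * w ^ 2))) ^ e \<noteq> w"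
  shows good_form
proof -
  have neg: "(- x) ^ q = - (x ^ q)" for x :: 'b
    using frob_add[of x "-x"] q_pos by (simp add: eq_neg_iff_add_eq_0 add.commute power_0_left)
  have diff: "(x - y) ^ q = x ^ q - y ^ q" for x y :: 'b
    using frob_add[of x "-y"] by (simp add: neg)
  have two: "(2::'b) ^ q = 2"
    using frob_add[of 1 1] by simp
  have w2q: "(w ^ 2) ^ q = w ^ 2" by (metis wq power_commutes power_mult mult.commute)
  note frob = frob_add diff power_mult_distrib power_divide Aq Bq wq w2q two
  have lines: "n1 ^ q = n1" "n2 ^ q = n2" "d1 ^ q = d1" "d2 ^ q = d2"
    by (simp_all add: n1_def n2_def d1_def d2_def frob)
  define \<tau> where "\<tau> = t ^ (3 * e)"
  have tq: "t ^ q = \<tau> * t" by (simp add: e \<tau>_def)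
  have "(t ^ 3) ^ q = t ^ 3" unfolding t by (simp add: frob)
  then have "\<tau> ^ 3 * t ^ 3 = t ^ 3"
    by (metis tq power_mult power_mult_distrib mult.commute)
  then have "\<tau> ^ 3 = 1" using t_nonzero by simp
  moreover have "\<tau> \<noteq> w" using t1 unfolding \<tau>_def power_mult t .
  ultimately have \<tau>: "\<tau> = 1 \<or> \<tau> = w ^ 2" using cube_root_of_unity[OF w, of "t ^ (3 * e)"] by (auto simp: \<tau>_def)
  have \<tau>0: "\<tau> \<noteq> 0" using \<open>\<tau> ^ 3 = 1\<close> by auto
  have r: "r1 ^ q = \<tau> * r1" "r2 ^ q = r2 / \<tau>"
    by (simp_all add: r1_def r2_def frob lines tq)
  \<comment> \<open>Trading division for a square leaves polynomial identities modulo
    \<open>w ^ 2 + w + 1\<close>.\<close>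
  have \<tau>inv: "x / \<tau> = x * \<tau> ^ 2" for x
    using \<open>\<tau> ^ 3 = 1\<close> \<tau>0 by (simp add: field_simps power2_eq_square power3_eq_cube)
  have key: "cyclic (y0 a b c) (y2 a b c) (y1 a b c)" if "\<tau> = 1" "cyclic a b c" for a b c
  proof -
    have abc: "a ^ q = b" "b ^ q = c" "c ^ q = a" using that(2) by (auto simp: cyclic_def)
    show ?thesis
      unfolding cyclic_def y0_def y1_def y2_def v0_def v1_def v2_def
      apply (simp only: frob abc r \<tau>inv)
      unfolding that(1) power_one mult_1_left mult_1_right
      by (intro conjI; use w in Groebner_Basis.algebra)
  qed
  have key': "cyclic (y0 a b c) (y1 a b c) (y2 a b c)" if "\<tau> = w ^ 2" "cyclic a b c" for a b c
  proof -
    have abc: "a ^ q = b" "b ^ q = c" "c ^ q = a" using that(2) by (auto simp: cyclic_def)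
    show ?thesis
      unfolding cyclic_def y0_def y1_def y2_def v0_def v1_def v2_def
      apply (simp only: frob abc r \<tau>inv)
      unfolding that(1)
      by (intro conjI; use w in Groebner_Basis.algebra)
  qed
  show ?thesis unfolding good_form_def using \<tau> key key' by blast
qed

text \<open>Frobenius now exchanges \<open>w\<close> and \<open>w ^ 2\<close>, and takes
  \<open>v1\<close> to \<open>\<tau> * w * v2\<close> with \<open>\<tau> = t ^ (q + 1)\<close>. The
  lines are fixed for \<open>\<tau> = w ^ 2\<close>, the excluded value, and cycled
  otherwise.\<close>

lemma good_form_inert:
  assumes wq: "w ^ q = w ^ 2" and e: "q + 1 = 3 * e"
    and t1: "((B + w ^ 2) * (B - 2 * w) / ((B + w) * (B - 2 * w ^ 2))) ^ e \<noteq> w ^ 2"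
  shows good_form
proof -
  have neg: "(- x) ^ q = - (x ^ q)" for x :: 'b
    using frob_add[of x "-x"] q_pos by (simp add: eq_neg_iff_add_eq_0 add.commute power_0_left)
  have diff: "(x - y) ^ q = x ^ q - y ^ q" for x y :: 'b
    using frob_add[of x "-y"] by (simp add: neg)
  have two: "(2::'b) ^ q = 2"
    using frob_add[of 1 1] by simp
  have "(w ^ 2) ^ q = (w ^ q) ^ 2" by (simp add: mult.commute flip: power_mult)
  also have "\<dots> = w" unfolding wq using w by Groebner_Basis.algebra
  finally have w2q: "(w ^ 2) ^ q = w" .
  note frob = frob_add diff power_mult_distrib power_divide Aq Bq wq w2q two
  have lines: "n1 ^ q = n2" "n2 ^ q = n1" "d1 ^ q = d2" "d2 ^ q = d1"
    by (simp_all add: n1_def n2_def d1_def d2_def frob)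
  define \<tau> where "\<tau> = t ^ (q + 1)"
  have tq: "t ^ q = \<tau> / t" using t_nonzero by (simp add: \<tau>_def)
  \<comment> \<open>Frobenius interchanges the numerator and the denominator of
    \<open>H(B)\<close>.\<close>
  have "(t ^ 3) ^ q = 1 / t ^ 3" unfolding t by (simp add: frob)
  then have "t ^ 3 * (t ^ 3) ^ q = 1" using t_nonzero by simp
  then have "\<tau> ^ 3 = 1" unfolding \<tau>_def by (simp add: power_add power_mult_distrib mult.commute flip: power_mult)
  moreover have "\<tau> \<noteq> w ^ 2" using t1 unfolding \<tau>_def e power_mult t .
  ultimately have \<tau>: "\<tau> = 1 \<or> \<tau> = w" using cube_root_of_unity[OF w, of "t ^ (q + 1)"] by (auto simp: \<tau>_def)
  have \<tau>0: "\<tau> \<noteq> 0" using \<open>\<tau> ^ 3 = 1\<close> by auto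
  have r: "r1 ^ q = \<tau> * r2" "r2 ^ q = r1 / \<tau>"
    using \<tau>0 t_nonzero by (simp_all add: r1_def r2_def frob lines tq mult.commute)
  have \<tau>inv: "x / \<tau> = x * \<tau> ^ 2" for x
    using \<open>\<tau> ^ 3 = 1\<close> \<tau>0 by (simp add: field_simps power2_eq_square power3_eq_cube)
  have key: "cyclic (y0 a b c) (y2 a b c) (y1 a b c)" if "\<tau> = 1" "cyclic a b c" for a b c
  proof -
    have abc: "a ^ q = b" "b ^ q = c" "c ^ q = a" using that(2) by (auto simp: cyclic_def)
    show ?thesis
      unfolding cyclic_def y0_def y1_def y2_def v0_def v1_def v2_def
      apply (simp only: frob abc r \<tau>inv)
      unfolding that(1) power_one mult_1_left mult_1_right
      by (intro conjI; use w in Groebner_Basis.algebra)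
  qed
  have key': "cyclic (y0 a b c) (y1 a b c) (y2 a b c)" if "\<tau> = w" "cyclic a b c" for a b c
  proof -
    have abc: "a ^ q = b" "b ^ q = c" "c ^ q = a" using that(2) by (auto simp: cyclic_def)
    show ?thesis
      unfolding cyclic_def y0_def y1_def y2_def v0_def v1_def v2_def
      apply (simp only: frob abc r \<tau>inv)
      unfolding that(1)
      by (intro conjI; use w in Groebner_Basis.algebra)
  qed
  show ?thesis unfolding good_form_def using \<tau> key key' by blast
qed

end

section \<open>Cubic residues in a finite field\<close>

text \<open>The field with \<open>q\<close> elements is realised as the fixed set of the
  \<open>q\<close>-power map in a larger field, where \<open>w\<close> and all cube roots are
  available.\<close>

locale fixed_field =
  fixes q h :: nat and w :: "'b::field"
  assumes char: "prime CHAR('b)" "CHAR('b) > 3" and q_eq: "q = CHAR('b) ^ h" and h: "h > 0"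
    and card_fixed: "card {x::'b. x ^ q = x} = q"
    and w: "w ^ 2 + w + 1 = 0"
    and cube_root: "\<And>x::'b. \<exists>t. t ^ 3 = x"
begin

definition "K = {x::'b. x ^ q = x}"

lemma card_K: "card K = q"
  using card_fixed by (simp add: K_def)

lemma q_gt_3: "q > 3"
proof -
  have "CHAR('b) ^ 1 \<le> q" unfolding q_eq using h char(2) by (intro power_increasing) auto
  then show ?thesis using char by simp
qed

lemma finite_K: "finite K"
  using card_K q_gt_3 by (metis card.infinite not_less_zero)

lemma frob_add: "(x + y :: 'b) ^ q = x ^ q + y ^ q"
  unfolding q_eq by (rule freshmans_dream'[OF char(1)]) simp

lemma frob_minus: "(- x :: 'b) ^ q = - (x ^ q)"
  using frob_add[of x "-x"] q_gt_3 by (simp add: eq_neg_iff_add_eq_0 add.commute power_0_left)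

lemma K_0 [simp]: "0 \<in> K" and K_1 [simp]: "1 \<in> K"
  and K_add: "x \<in> K \<Longrightarrow> y \<in> K \<Longrightarrow> x + y \<in> K"
  and K_mult: "x \<in> K \<Longrightarrow> y \<in> K \<Longrightarrow> x * y \<in> K"
  and K_minus: "x \<in> K \<Longrightarrow> - x \<in> K"
  and K_inverse: "x \<in> K \<Longrightarrow> inverse x \<in> K"
  and K_power: "x \<in> K \<Longrightarrow> x ^ n \<in> K"
  using q_gt_3 by (auto simp: K_def power_mult_distrib frob_minus frob_add power_inverse power_0_left
      mult.commute power_mult[symmetric]) (metis power_mult mult.commute)

lemma K_diff: "x \<in> K \<Longrightarrow> y \<in> K \<Longrightarrow> x - y \<in> K"
  using K_add[of x "-y"] K_minus by simp

lemma K_divide: "x \<in> K \<Longrightarrow> y \<in> K \<Longrightarrow> x / y \<in> K"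
  using K_mult[of x "inverse y"] K_inverse by (simp add: divide_inverse)

lemma K_of_nat: "of_nat n \<in> K"
  by (induction n) (auto intro: K_add)

lemma K_numeral: "numeral n \<in> K"
  using K_of_nat[of "numeral n"] by simp

lemma of_nat_nonzero: "0 < n \<Longrightarrow> n < CHAR('b) \<Longrightarrow> of_nat n \<noteq> (0::'b)"
  by (simp add: of_nat_eq_0_iff_char_dvd nat_dvd_not_less)

lemma two_three_nonzero: "(2::'b) \<noteq> 0" "(3::'b) \<noteq> 0"
  using of_nat_nonzero[of 2] of_nat_nonzero[of 3] char by auto

lemma w3: "w ^ 3 = 1"
  using w by Groebner_Basis.algebra

lemma w_nonzero: "w \<noteq> 0"
  using w by auto

lemma w_distinct: "w \<noteq> 1" "w ^ 2 \<noteq> 1" "w \<noteq> w ^ 2"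
proof -
  have "(w - 1) * (w ^ 2 - 1) = 3" "(w - w ^ 2) * (w ^ 2 - w) = 3" using w by Groebner_Basis.algebra+
  then show "w \<noteq> 1" "w ^ 2 \<noteq> 1" "w \<noteq> w ^ 2" using two_three_nonzero by auto
qed

lemma K_power_minus_one: "x \<in> K \<Longrightarrow> x \<noteq> 0 \<Longrightarrow> x ^ (q - 1) = 1"
  using q_gt_3 power_minus_mult[of q x] by (simp add: K_def)

lemma sum_K_mult: "d \<in> K \<Longrightarrow> d \<noteq> 0 \<Longrightarrow> (\<Sum>x\<in>K. f (d * x)) = (\<Sum>x\<in>K. f x)"
  by (rule sum.reindex_bij_witness[of _ "\<lambda>x. x / d" "\<lambda>x. d * x"]) (auto intro: K_mult K_divide)

lemma sum_K_add: "d \<in> K \<Longrightarrow> (\<Sum>x\<in>K. f (d + x)) = (\<Sum>x\<in>K. f x)"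
  by (rule sum.reindex_bij_witness[of _ "\<lambda>x. x - d" "\<lambda>x. d + x"]) (auto intro: K_add K_diff)

end

section \<open>The cubic character and its Jacobi sums for \<open>q\<close> congruent to
  \<open>1\<close> modulo \<open>3\<close>\<close>

locale split_fixed_field = fixed_field q h w for q h :: nat and w :: "'b::field" +
  fixes e :: nat
  assumes e: "q = 3 * e + 1"
begin

lemma e_pos: "e > 0"
  using q_gt_3 e by simp

lemma K_power_e: "x \<in> K \<Longrightarrow> x \<noteq> 0 \<Longrightarrow> x ^ e = 1 \<or> x ^ e = w \<or> x ^ e = w ^ 2"
  using K_power_minus_one[of x] by (intro cube_root_of_unity w) (simp add: e power_mult mult.commute flip: power_mult)

definition "\<zeta> = Complex (- 1 / 2) (sqrt 3 / 2)"

lemma \<zeta>: "\<zeta> ^ 2 + \<zeta> + 1 = 0" "cnj \<zeta> = \<zeta> ^ 2" "\<zeta> * \<zeta> ^ 2 = 1" "\<zeta> \<noteq> 1" "\<zeta> ^ 2 * \<zeta> ^ 2 = \<zeta>"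
  by (simp_all add: \<zeta>_def complex_eq_iff power2_eq_square)

text \<open>The cubic residue character, matching \<open>w\<close> with the complex root
  \<open>\<zeta>\<close>. The last branch supplies the value \<open>0\<close> at
  \<open>0\<close>.\<close>

definition \<chi> :: "'b \<Rightarrow> complex" where
  "\<chi> x = (if x ^ e = 1 then 1 else if x ^ e = w then \<zeta> else if x ^ e = w ^ 2 then \<zeta> ^ 2 else 0)"

lemma \<chi>_0 [simp]: "\<chi> 0 = 0"
  using e_pos w_nonzero by (simp add: \<chi>_def power_0_left)

lemma \<chi>_mult:
  assumes "x \<in> K" "y \<in> K"
  shows "\<chi> (x * y) = \<chi> x * \<chi> y"
proof (cases "x = 0 \<or> y = 0")
  case False
  define w' z' where "w' = w ^ 2" and "z' = \<zeta> ^ 2"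
  have "w * w' = 1" "w' * w = 1" "w' * w' = w" "w * w = w'"
    unfolding w'_def using w by (Groebner_Basis.algebra, Groebner_Basis.algebra, Groebner_Basis.algebra, simp add: power2_eq_square)
  moreover have "\<zeta> * z' = 1" "z' * \<zeta> = 1" "z' * z' = \<zeta>" "\<zeta> * \<zeta> = z'"
    unfolding z'_def using \<zeta>(1) by (Groebner_Basis.algebra, Groebner_Basis.algebra, Groebner_Basis.algebra, simp add: power2_eq_square)
  moreover have "w \<noteq> 1" "w' \<noteq> 1" "w \<noteq> w'" using w_distinct by (simp_all add: w'_def)
  moreover have "x ^ e = 1 \<or> x ^ e = w \<or> x ^ e = w'" "y ^ e = 1 \<or> y ^ e = w \<or> y ^ e = w'"
    using K_power_e assms False by (auto simp: w'_def)
  ultimately show ?thesis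
    unfolding \<chi>_def power_mult_distrib w'_def[symmetric] z'_def[symmetric] by (elim disjE; simp)
qed auto

lemma \<chi>_values:
  assumes "x \<in> K" "x \<noteq> 0"
  shows "x ^ e = 1 \<and> \<chi> x = 1 \<or> x ^ e \<noteq> 1 \<and> (\<chi> x = \<zeta> \<or> \<chi> x = \<zeta> ^ 2)"
  using K_power_e[OF assms] w_distinct unfolding \<chi>_def by (elim disjE; simp)

lemma cnj_\<zeta>_square: "cnj (\<zeta> ^ 2) = \<zeta>" "\<zeta> ^ 2 * \<zeta> = 1" "(\<zeta> ^ 2) ^ 2 = \<zeta>"
  by (simp_all add: \<zeta>_def complex_eq_iff power2_eq_square)

lemma \<chi>_norm: "x \<in> K \<Longrightarrow> x \<noteq> 0 \<Longrightarrow> \<chi> x * cnj (\<chi> x) = 1"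
  using \<chi>_values[of x] \<zeta>(2,3) cnj_\<zeta>_square by (metis complex_cnj_one mult_1)

lemma \<chi>_square: "x \<in> K \<Longrightarrow> \<chi> x ^ 2 = cnj (\<chi> x)"
proof -
  have "u ^ 2 = cnj u" if "u = 0 \<or> u = 1 \<or> u = \<zeta> \<or> u = \<zeta> ^ 2" for u
    using that by (elim disjE) (simp_all only: \<zeta>(2) cnj_\<zeta>_square, simp_all)
  moreover assume "x \<in> K"
  then have "\<chi> x = 0 \<or> \<chi> x = 1 \<or> \<chi> x = \<zeta> \<or> \<chi> x = \<zeta> ^ 2"
    using \<chi>_values[of x] by (cases "x = 0") auto
  ultimately show ?thesis by blast
qed

text \<open>Otherwise all \<open>3 * e\<close> nonzero elements of \<open>K\<close> would be roots
  of a polynomial of degree \<open>e\<close>.\<close>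

lemma \<chi>_nontrivial: "\<exists>g\<in>K. g \<noteq> 0 \<and> \<chi> g \<noteq> 1"
proof (rule ccontr)
  assume *: "\<not> ?thesis"
  have "x ^ e = 1" if "x \<in> K - {0}" for x
  proof -
    have "\<zeta> ^ 2 \<noteq> 1" by (metis \<zeta>(3,4) mult.right_neutral)
    then show ?thesis using * that \<chi>_values[of x] \<zeta>(4) by auto
  qed
  then have "K - {0} \<subseteq> {x. poly (monom 1 e - 1) x = 0}"
    by (auto simp: poly_monom)
  moreover have ne: "monom 1 e - 1 \<noteq> (0::'b poly)"
  proof
    assume "monom 1 e - 1 = (0::'b poly)"
    then have "degree (monom (1::'b) e) = degree (1::'b poly)" by simp
    then show False using e_pos by (simp add: degree_monom_eq)
  qed
  ultimately have "card (K - {0}) \<le> card {x. poly (monom 1 e - 1) x = (0::'b)}"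
    by (intro card_mono poly_roots_finite)
  also have "\<dots> \<le> degree (monom 1 e - 1 :: 'b poly)" by (rule card_poly_roots_bound[OF ne])
  also have "\<dots> \<le> e" by (intro degree_diff_le) (auto simp: degree_monom_le)
  finally have "card (K - {0}) \<le> e" .
  moreover have "card (K - {0}) = q - 1" using card_K finite_K by simp
  ultimately show False using e e_pos by linarith
qed

lemma sum_\<chi>: "(\<Sum>x\<in>K. \<chi> x) = 0"
proof -
  obtain g where g: "g \<in> K" "g \<noteq> 0" "\<chi> g \<noteq> 1" using \<chi>_nontrivial by blast
  have "(\<Sum>x\<in>K. \<chi> x) = (\<Sum>x\<in>K. \<chi> (g * x))" using sum_K_mult[OF g(1,2), of \<chi>] by simp
  also have "\<dots> = \<chi> g * (\<Sum>x\<in>K. \<chi> x)" using g by (simp add: \<chi>_mult sum_distrib_left)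
  finally show ?thesis using g(3) by simp
qed

definition "J d = (\<Sum>y\<in>K. \<chi> y * \<chi> (y + d))"

text \<open>
  The autocorrelation of \<open>\<chi>\<close> gives the mean square of the Jacobi sums \<open>J d\<close>, which all have the same
  modulus for \<open>d \<noteq> 0\<close>.
\<close>

definition "C d = (\<Sum>x\<in>K. \<chi> x * cnj (\<chi> (d + x)))"

lemma C_0: "C 0 = of_nat q - 1"
proof -
  have "C 0 = (\<Sum>x\<in>K. if x = 0 then 0 else 1)"
    unfolding C_def by (intro sum.cong) (auto simp: \<chi>_norm)
  also have "\<dots> = of_nat (card (K - {0}))"
    using finite_K by (simp add: sum.If_cases Int_def set_diff_eq)
  finally show ?thesis using card_K finite_K q_gt_3 by (simp add: of_nat_diff)
qed

lemma C_scale: "d \<in> K \<Longrightarrow> d \<noteq> 0 \<Longrightarrow> C d = C 1"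
proof -
  assume d: "d \<in> K" "d \<noteq> 0"
  have "C d = (\<Sum>x\<in>K. \<chi> (d * x) * cnj (\<chi> (d + d * x)))"
    unfolding C_def using sum_K_mult[OF d, of "\<lambda>x. \<chi> x * cnj (\<chi> (d + x))"] by simp
  also have "\<dots> = (\<Sum>x\<in>K. (\<chi> d * cnj (\<chi> d)) * (\<chi> x * cnj (\<chi> (1 + x))))"
  proof (rule sum.cong)
    fix x assume x: "x \<in> K"
    have "\<chi> (d + d * x) = \<chi> d * \<chi> (1 + x)"
      using \<chi>_mult[of d "1 + x"] d x by (simp add: K_add distrib_left)
    then show "\<chi> (d * x) * cnj (\<chi> (d + d * x)) = (\<chi> d * cnj (\<chi> d)) * (\<chi> x * cnj (\<chi> (1 + x)))"
      using d x by (simp add: \<chi>_mult)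
  qed simp
  finally show ?thesis using \<chi>_norm[OF d] by (simp add: C_def)
qed

text \<open>\<open>C\<close> is constant on nonzero arguments and its total is \<open>0\<close>
  because \<open>\<chi>\<close> sums to \<open>0\<close>; \<open>C 0 = q - 1\<close> then leaves
  \<open>-1\<close>.\<close>

lemma C_nonzero: "d \<in> K \<Longrightarrow> d \<noteq> 0 \<Longrightarrow> C d = - 1"
proof -
  assume d: "d \<in> K" "d \<noteq> 0"
  have "(\<Sum>d\<in>K. C d) = (\<Sum>x\<in>K. \<chi> x * cnj (\<Sum>d\<in>K. \<chi> (x + d)))"
    unfolding C_def by (subst sum.swap) (simp add: sum_distrib_left add.commute)
  also have "\<dots> = 0"
    by (simp add: sum_K_add sum_\<chi>)
  finally have "C 0 + (\<Sum>d\<in>K - {0}. C d) = 0"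
    unfolding sum.remove[OF finite_K K_0] .
  moreover have "(\<Sum>d\<in>K - {0}. C d) = (of_nat q - 1) * C 1"
  proof -
    have "(\<Sum>d\<in>K - {0}. C d) = (\<Sum>d\<in>K - {0}. C 1)"
      by (intro sum.cong refl C_scale) auto
    then show ?thesis using card_K finite_K q_gt_3 by (simp add: of_nat_diff)
  qed
  ultimately have "(of_nat q - 1) + (of_nat q - 1) * C 1 = 0" by (simp only: C_0)
  then have "(of_nat q - 1) * (C 1 + 1) = 0" by (simp add: algebra_simps)
  moreover have "of_nat q - 1 \<noteq> (0::complex)" using q_gt_3 by (simp del: of_nat_eq_1_iff add: of_nat_eq_1_iff)
  ultimately show ?thesis using C_scale[OF d] by (simp add: add_eq_0_iff2)
qed

lemma J_scale: "d \<in> K \<Longrightarrow> d \<noteq> 0 \<Longrightarrow> J d = \<chi> d ^ 2 * J 1"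
proof -
  assume d: "d \<in> K" "d \<noteq> 0"
  have "J d = (\<Sum>x\<in>K. \<chi> (d * x) * \<chi> (d * x + d))"
    unfolding J_def using sum_K_mult[OF d, of "\<lambda>x. \<chi> x * \<chi> (x + d)"] by simp
  also have "\<dots> = (\<Sum>x\<in>K. \<chi> d ^ 2 * (\<chi> x * \<chi> (x + 1)))"
  proof (rule sum.cong)
    fix x assume x: "x \<in> K"
    have "\<chi> (d * x + d) = \<chi> d * \<chi> (x + 1)"
      using \<chi>_mult[of d "x + 1"] d x by (simp add: K_add distrib_left)
    then show "\<chi> (d * x) * \<chi> (d * x + d) = \<chi> d ^ 2 * (\<chi> x * \<chi> (x + 1))"
      using d x by (simp add: \<chi>_mult power2_eq_square)
  qed simp
  finally show ?thesis by (simp add: J_def sum_distrib_left)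
qed

lemma J_0: "J 0 = 0"
proof -
  have "J 0 = cnj (\<Sum>x\<in>K. \<chi> x)"
    unfolding J_def by (simp add: \<chi>_square flip: power2_eq_square)
  then show ?thesis by (simp add: sum_\<chi>)
qed

text \<open>Summing the squared moduli over \<open>d\<close> first produces
  \<open>C (z - y)\<close>, whose two values give the total \<open>q * (q - 1)\<close>. Since
  \<open>J 0 = 0\<close>, it is shared equally by the \<open>q - 1\<close> nonzero
  \<open>d\<close>.\<close>

lemma J_norm:
  assumes d: "d \<in> K" "d \<noteq> 0"
  shows "J d * cnj (J d) = of_nat q"
proof -
  have scale: "J d * cnj (J d) = J 1 * cnj (J 1)" if "d \<in> K" "d \<noteq> 0" for d
  proof -
    have "J d * cnj (J d) = (\<chi> d * cnj (\<chi> d)) ^ 2 * (J 1 * cnj (J 1))"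
      unfolding J_scale[OF that] by (simp add: power2_eq_square)
    then show ?thesis using \<chi>_norm[OF that] by simp
  qed
  have q1: "of_nat q - 1 \<noteq> (0::complex)"
    using q_gt_3 by (simp del: of_nat_eq_1_iff add: of_nat_eq_1_iff)
  have "(\<Sum>d\<in>K. J d * cnj (J d)) = J 0 * cnj (J 0) + (\<Sum>d\<in>K - {0}. J d * cnj (J d))"
    by (rule sum.remove[OF finite_K K_0])
  also have "(\<Sum>d\<in>K - {0}. J d * cnj (J d)) = (\<Sum>d\<in>K - {0}. J 1 * cnj (J 1))"
    by (intro sum.cong refl scale) auto
  also have "\<dots> = (of_nat q - 1) * (J 1 * cnj (J 1))"
    using card_K finite_K q_gt_3 by (simp add: of_nat_diff)
  finally have lhs: "(\<Sum>d\<in>K. J d * cnj (J d)) = (of_nat q - 1) * (J 1 * cnj (J 1))" by (simp add: J_0)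
  have "(\<Sum>d\<in>K. J d * cnj (J d)) =
      (\<Sum>d\<in>K. \<Sum>y\<in>K. \<Sum>z\<in>K. \<chi> y * cnj (\<chi> z) * (\<chi> (y + d) * cnj (\<chi> (z + d))))"
    unfolding J_def cnj_sum sum_product by (simp add: mult_ac)
  also have "\<dots> = (\<Sum>y\<in>K. \<Sum>d\<in>K. \<Sum>z\<in>K. \<chi> y * cnj (\<chi> z) * (\<chi> (y + d) * cnj (\<chi> (z + d))))"
    by (rule sum.swap)
  also have "\<dots> = (\<Sum>y\<in>K. \<Sum>z\<in>K. \<Sum>d\<in>K. \<chi> y * cnj (\<chi> z) * (\<chi> (y + d) * cnj (\<chi> (z + d))))"
    by (intro sum.cong refl sum.swap)
  also have "\<dots> = (\<Sum>y\<in>K. \<Sum>z\<in>K. \<chi> y * cnj (\<chi> z) * C (z - y))"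
  proof (intro sum.cong refl)
    fix y z assume y: "y \<in> K" and z: "z \<in> K"
    have "C (z - y) = (\<Sum>d\<in>K. \<chi> (y + d) * cnj (\<chi> ((z - y) + (y + d))))"
      unfolding C_def using sum_K_add[OF y, of "\<lambda>x. \<chi> x * cnj (\<chi> ((z - y) + x))"] by simp
    then show "(\<Sum>d\<in>K. \<chi> y * cnj (\<chi> z) * (\<chi> (y + d) * cnj (\<chi> (z + d)))) = \<chi> y * cnj (\<chi> z) * C (z - y)"
      by (simp add: sum_distrib_left algebra_simps)
  qed
  also have "\<dots> = (\<Sum>y\<in>K. \<Sum>z\<in>K. (if z = y then of_nat q * (\<chi> y * cnj (\<chi> y)) else 0) - \<chi> y * cnj (\<chi> z))"
    by (intro sum.cong refl) (auto simp: C_0 C_nonzero K_diff algebra_simps)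
  also have "\<dots> = of_nat q * (\<Sum>y\<in>K. \<chi> y * cnj (\<chi> y)) - (\<Sum>y\<in>K. \<chi> y) * cnj (\<Sum>y\<in>K. \<chi> y)"
    unfolding cnj_sum sum_product using finite_K by (simp add: sum_subtractf sum_distrib_left)
  also have "(\<Sum>y\<in>K. \<chi> y * cnj (\<chi> y)) = of_nat q - 1"
    using C_0 by (simp add: C_def)
  finally have "(of_nat q - 1) * (J 1 * cnj (J 1)) = (of_nat q - 1) * of_nat q"
    unfolding lhs by (simp add: sum_\<chi> mult.commute)
  then have "J 1 * cnj (J 1) = of_nat q" using q1 by simp
  then show ?thesis using scale[OF d] by simp
qed

text \<open>\<open>1 + \<chi> u + cnj (\<chi> u)\<close> is \<open>3\<close> at nonzero cubes,
  \<open>1\<close> at \<open>0\<close> and \<open>0\<close> elsewhere on \<open>K\<close>. Summing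
  over \<open>u = y * (y + d)\<close>, which vanishes twice, expresses the count by
  \<open>Re (J d)\<close>.\<close>

lemma card_cubic_residues_ge:
  assumes d: "d \<in> K" "d \<noteq> 0"
  shows "3 * real (card {y\<in>K. (y * (y + d)) ^ e = 1}) \<ge> real q - 2 - 2 * sqrt (real q)"
proof -
  let ?N = "{y\<in>K. (y * (y + d)) ^ e = 1}"
  have dK: "-d \<in> K" using d K_minus by simp
  have "1 + \<chi> (y * (y + d)) + cnj (\<chi> (y * (y + d))) =
      (if y \<in> ?N then 3 else 0) + (if y \<in> {0, -d} then 1 else 0)" if y: "y \<in> K" for y
  proof -
    have mem: "y * (y + d) \<in> K" using y d by (intro K_mult K_add)
    have z: "1 + \<zeta> + \<zeta> ^ 2 = 0" "1 + \<zeta> ^ 2 + \<zeta> = 0"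
      using \<zeta>(1) by (simp_all add: add_ac)
    show ?thesis
    proof (cases "y = 0 \<or> y = - d")
      case True
      then show ?thesis using d e_pos by (auto simp: power_0_left)
    next
      case False
      then have "y * (y + d) \<noteq> 0" by (simp add: add_eq_0_iff2)
      from \<chi>_values[OF mem this] show ?thesis
      proof (elim disjE conjE)
        assume "\<chi> (y * (y + d)) = \<zeta>" "(y * (y + d)) ^ e \<noteq> 1"
        then show ?thesis using False z(1) \<zeta>(2) by simp
      next
        assume "\<chi> (y * (y + d)) = \<zeta> ^ 2" "(y * (y + d)) ^ e \<noteq> 1"
        then show ?thesis using False z(2) cnj_\<zeta>_square(1) by simp
      qed (use False y in simp)
    qed
  qed
  then have "(\<Sum>y\<in>K. 1 + \<chi> (y * (y + d)) + cnj (\<chi> (y * (y + d)))) =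
      (\<Sum>y\<in>K. (if y \<in> ?N then 3 else 0) + (if y \<in> {0, -d} then 1 else 0))" by simp
  also have "\<dots> = 3 * of_nat (card ?N) + of_nat (card {0, -d})"
  proof -
    have "K \<inter> {0, -d} = {0, -d}" "K \<inter> ?N = ?N" using dK by auto
    then show ?thesis unfolding sum.distrib sum.inter_restrict[OF finite_K, symmetric] by simp
  qed
  also have "card {0, -d} = 2" using d by simp
  finally have *: "(\<Sum>y\<in>K. 1 + \<chi> (y * (y + d)) + cnj (\<chi> (y * (y + d)))) = 3 * of_nat (card ?N) + 2" by simp
  have "(\<Sum>y\<in>K. \<chi> (y * (y + d))) = J d"
    unfolding J_def using d by (intro sum.cong) (auto simp: \<chi>_mult K_add)
  then have "of_nat q + J d + cnj (J d) = 3 * of_nat (card ?N) + 2"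
    using * finite_K card_K by (simp add: sum.distrib flip: cnj_sum)
  then have "Re (of_nat q + J d + cnj (J d)) = Re (3 * of_nat (card ?N) + 2)" by simp
  then have N: "real q + 2 * Re (J d) = 3 * real (card ?N) + 2" by simp
  have "norm (J d) ^ 2 = real q"
    using J_norm[OF d] by (metis complex_norm_square of_real_eq_iff of_real_of_nat_eq)
  then have "norm (J d) = sqrt (real q)" by (metis norm_ge_zero real_sqrt_unique)
  then have "- sqrt (real q) \<le> Re (J d)" using abs_Re_le_cmod[of "J d"] by simp
  then show ?thesis using N by simp
qed

end

section \<open>Counting\<close>

text \<open>For small \<open>q\<close> the claimed bound is trivial; \<open>25\<close> lies just
  below the positive root \<open>11 + sqrt 200\<close> of
  \<open>s ^ 2 - 22 * s - 79\<close>.\<close>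

lemma target_nonpos:
  assumes "sqrt (real q) < 25"
  shows "(real q - 22 * sqrt (real q) - 79) / 6 \<le> 0"
proof -
  have "real q = sqrt (real q) * sqrt (real q)" by simp
  also have "\<dots> \<le> sqrt (real q) * 25" using assms by (intro mult_left_mono) auto
  finally have "real q - 22 * sqrt (real q) - 79 < 0" using assms by linarith
  then show ?thesis by simp
qed

lemma q_ge_625:
  assumes "\<not> sqrt (real q) < 25"
  shows "q \<ge> 625"
proof -
  have "25 * 25 \<le> sqrt (real q) * sqrt (real q)" using assms by (intro mult_mono) auto
  then show ?thesis by simp
qed

section \<open>Good pairs in the larger field\<close>

context fixed_field
begin

definition "a1 B = B + w"
definition "a2 B = B + w ^ 2"
definition "b1 B = B - 2 * w"
definition "b2 B = B - 2 * w ^ 2"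

lemmas factor_defs = a1_def a2_def b1_def b2_def

text \<open>The \<open>B\<close> for which \<open>A\<close> is nonzero on the curve and
  \<open>H(B)\<close> has neither a zero nor a pole.\<close>

definition "\<Omega> = {B \<in> K. a1 B \<noteq> 0 \<and> a2 B \<noteq> 0 \<and> b1 B \<noteq> 0 \<and> b2 B \<noteq> 0}"

text \<open>The domain stands for the field with \<open>q ^ 3\<close> elements; for a map of a
  finite field to itself, injectivity means permutation.\<close>

definition "permuting A B \<longleftrightarrow> inj_on (\<lambda>x::'b. x ^ (q ^ 2 + q - 1) + A * x ^ (q ^ 3 - q ^ 2 + q) + B * x) {x. x ^ q ^ 3 = x}"

definition "good_pairs = {(A, B). A \<in> K \<and> B \<in> K \<and> A ^ 3 + B ^ 2 - B + 1 = 0 \<and> B \<noteq> 0 \<and> B \<noteq> - 1 \<and> permuting A B}"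

lemma finite_\<Omega>: "finite \<Omega>"
  using finite_K by (simp add: \<Omega>_def)

lemma card_\<Omega>: "card \<Omega> + 4 \<ge> q"
proof -
  have "K \<subseteq> \<Omega> \<union> {- w, - (w ^ 2), 2 * w, 2 * w ^ 2}"
    by (auto simp: \<Omega>_def factor_defs add_eq_0_iff2)
  then have "card K \<le> card (\<Omega> \<union> {- w, - (w ^ 2), 2 * w, 2 * w ^ 2})"
    using finite_\<Omega> by (intro card_mono) auto
  also have "\<dots> \<le> card \<Omega> + card {- w, - (w ^ 2), 2 * w, 2 * w ^ 2}"
    by (rule card_Un_le)
  also have "card {- w, - (w ^ 2), 2 * w, 2 * w ^ 2} \<le> 4"
    by (simp add: card_insert_if)
  finally show ?thesis using card_K by simp
qed

lemma curve_factor: "A ^ 3 + B ^ 2 - B + 1 = 0 \<longleftrightarrow> A ^ 3 = - (a1 B * a2 B)"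
proof -
  have "a1 B * a2 B = B ^ 2 - B + 1" unfolding factor_defs using w by Groebner_Basis.algebra
  then have "A ^ 3 + B ^ 2 - B + 1 = A ^ 3 + a1 B * a2 B" by simp
  then show ?thesis by (simp only: eq_neg_iff_add_eq_0)
qed

lemma finite_good_pairs: "finite good_pairs"
proof (rule finite_subset)
  show "good_pairs \<subseteq> K \<times> K" by (auto simp: good_pairs_def)
qed (use finite_K in simp)

lemma roots_ne: "- w \<noteq> - (w ^ 2)" "- w \<noteq> 2 * w" "- w \<noteq> 2 * w ^ 2" "- (w ^ 2) \<noteq> 2 * w" "- (w ^ 2) \<noteq> 2 * w ^ 2"
proof -
  have n: "3 * w ^ 2 \<noteq> 0" "(3::'b) \<noteq> 0"
    using two_three_nonzero w_nonzero by auto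
  show "- w \<noteq> - (w ^ 2)" using w_distinct by simp
  show "- w \<noteq> 2 * w"
  proof
    assume "- w = 2 * w"
    then have "3 * w ^ 2 = 0" by Groebner_Basis.algebra
    with n show False by simp
  qed
  have w2: "w ^ 2 = - 1 - w" using w by Groebner_Basis.algebra
  show "- w \<noteq> 2 * w ^ 2"
  proof
    assume "- w = 2 * w ^ 2"
    then have "- w - 2 * (- 1 - w) = 0" by (simp only: w2) simp
    then have "w = - 2" by (simp add: eq_neg_iff_add_eq_0 algebra_simps)
    then have "(3::'b) = 0" using w by simp
    with n show False by simp
  qed
  show "- (w ^ 2) \<noteq> 2 * w"
  proof
    assume *: "- (w ^ 2) = 2 * w"
    have "w - 1 = 2 * w - (- (w ^ 2))" by (simp only: w2) simp
    then have "w - 1 = 0" by (simp only: * diff_self)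
    then show False using w_distinct(1) by simp
  qed
  show "- (w ^ 2) \<noteq> 2 * w ^ 2"
  proof
    assume "- (w ^ 2) = 2 * w ^ 2"
    then have "3 * w ^ 2 = 0" by Groebner_Basis.algebra
    with n show False by simp
  qed
qed

text \<open>Any cube root of \<open>H(B)\<close> in the larger field gives an instance of the
  permutation criterion; \<open>cls\<close> lists its split and inert cases.\<close>

lemma good_pairI:
  assumes AB: "A \<in> K" "B \<in> \<Omega>" "A ^ 3 = - (a1 B * a2 B)" "B \<noteq> 0" "B \<noteq> 1" "B \<noteq> - 1"
    and cls: "w ^ q = w \<and> q = 3 * e + 1 \<and> (a2 B * b1 B / (a1 B * b2 B)) ^ e \<noteq> w \<or>
      w ^ q = w ^ 2 \<and> q + 1 = 3 * e \<and> (a2 B * b1 B / (a1 B * b2 B)) ^ e \<noteq> w ^ 2"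
  shows "(A, B) \<in> good_pairs"
proof -
  obtain t where t: "t ^ 3 = a2 B * b1 B / (a1 B * b2 B)" using cube_root by blast
  have curve: "A ^ 3 + B ^ 2 - B + 1 = 0" using AB(3) curve_factor by blast
  have "b1 B * b2 B = B ^ 2 + 2 * B + 4" unfolding factor_defs using w by Groebner_Basis.algebra
  then have D: "B ^ 2 + 2 * B + 4 \<noteq> 0" using AB(2) by (auto simp: \<Omega>_def)
  have A0: "A \<noteq> 0" using AB(2,3) by (auto simp: \<Omega>_def)
  interpret split_form w A B t q
    using w two_three_nonzero(2) frob_add curve A0 AB(1,2,4-6) D t
    by unfold_locales (auto simp: factor_defs K_def \<Omega>_def)
  have good_form
    using cls good_form_split[of e] good_form_inert[of e] unfolding factor_defs by blast
  then have "permuting A B"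
    unfolding permuting_def using F_injective unfolding F_def by (auto intro!: inj_onI)
  then show ?thesis using AB(1,2,4-6) curve by (simp add: good_pairs_def \<Omega>_def)
qed

end

section \<open>Counting for \<open>q\<close> congruent to \<open>1\<close> modulo
  \<open>3\<close>\<close>

context split_fixed_field
begin

lemma w_in_K: "w \<in> K" "w ^ q = w"
proof -
  show "w ^ q = w" using w3 by (simp add: e power_mult)
  then show "w \<in> K" by (simp add: K_def)
qed

lemma factors_in_K: "B \<in> K \<Longrightarrow> a1 B \<in> K \<and> a2 B \<in> K \<and> b1 B \<in> K \<and> b2 B \<in> K"
  unfolding factor_defs using w_in_K by (auto intro!: K_add K_diff K_mult K_numeral K_power)

lemma power_3e: "x \<in> K \<Longrightarrow> x \<noteq> 0 \<Longrightarrow> x ^ (3 * e) = 1"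
  using K_power_minus_one[of x] by (simp add: e)

text \<open>The product with complementary exponents, times the given one, consists of
  \<open>3 * e\<close>-th powers and is \<open>1\<close>. Hence both products are constant on the
  class, \<open>w\<close> and \<open>w ^ 2\<close>.\<close>

lemma class_card_le:
  assumes c: "c1 \<noteq> c2" "c1 \<noteq> c3" "c1 \<noteq> c4" and cK: "c1 \<in> K" "c2 \<in> K" "c3 \<in> K" "c4 \<in> K"
    and m1: "m1 = 1 \<and> n1 = 2 \<or> m1 = 2 \<and> n1 = 1"
    and mn: "m1 + n1 = 3 * k1" "m2 + n2 = 3 * k2" "m3 + n3 = 3 * k3" "m4 + n4 = 3 * k4"
    and m: "m1 + m2 + m3 + m4 \<le> 6" and n: "n1 + n2 + n3 + n4 \<le> 6" and e35: "e \<ge> 35"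
  shows "4 * card {z \<in> K. z \<noteq> c1 \<and> z \<noteq> c2 \<and> z \<noteq> c3 \<and> z \<noteq> c4 \<and>
     (z - c1) ^ (m1 * e) * (z - c2) ^ (m2 * e) * (z - c3) ^ (m3 * e) * (z - c4) ^ (m4 * e) = w} \<le> 2 * q + 36"
proof (rule stepanov_cubic_class[where \<pi> = "[:w:]" and \<rho> = "[:w ^ 2:]", OF c m1 m n char q_eq e35])
  fix z assume "z \<in> {z \<in> K. z \<noteq> c1 \<and> z \<noteq> c2 \<and> z \<noteq> c3 \<and> z \<noteq> c4 \<and>
     (z - c1) ^ (m1 * e) * (z - c2) ^ (m2 * e) * (z - c3) ^ (m3 * e) * (z - c4) ^ (m4 * e) = w}"
  then have z: "z \<in> K" "z \<noteq> c1" "z \<noteq> c2" "z \<noteq> c3" "z \<noteq> c4" and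
    val: "(z - c1) ^ (m1 * e) * (z - c2) ^ (m2 * e) * (z - c3) ^ (m3 * e) * (z - c4) ^ (m4 * e) = w" by auto
  have one: "(z - c) ^ (m * e) * (z - c) ^ (n * e) = 1" if "c \<in> K" "z \<noteq> c" "m + n = 3 * k" for c m n k
  proof -
    have "(z - c) ^ (m * e) * (z - c) ^ (n * e) = (z - c) ^ ((m + n) * e)"
      by (simp add: power_add distrib_right)
    also have "(m + n) * e = 3 * e * k" using that(3) by simp
    also have "(z - c) ^ (3 * e * k) = 1"
      unfolding power_mult[of _ "3 * e"] using power_3e[of "z - c"] K_diff[of z c] z that by simp
    finally show ?thesis .
  qed
  let ?Y = "(z - c1) ^ (n1 * e) * (z - c2) ^ (n2 * e) * (z - c3) ^ (n3 * e) * (z - c4) ^ (n4 * e)"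
  have "w * ?Y = ((z - c1) ^ (m1 * e) * (z - c1) ^ (n1 * e)) * ((z - c2) ^ (m2 * e) * (z - c2) ^ (n2 * e))
      * ((z - c3) ^ (m3 * e) * (z - c3) ^ (n3 * e)) * ((z - c4) ^ (m4 * e) * (z - c4) ^ (n4 * e))"
    unfolding val[symmetric] by (simp only: mult_ac)
  also have "\<dots> = 1"
    using one[OF cK(1) z(2) mn(1)] one[OF cK(2) z(3) mn(2)] one[OF cK(3) z(4) mn(3)] one[OF cK(4) z(5) mn(4)] by simp
  finally have "w * ?Y = w * w ^ 2" using w3 by (simp add: power3_eq_cube power2_eq_square mult.assoc)
  then show "?Y = poly [:w ^ 2:] z" using w_nonzero by simp
next
  show "2 * e + 35 \<le> q" "6 * e \<le> 2 * q + 2" using e e35 by auto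
qed (use finite_K in \<open>auto simp: K_def\<close>)

text \<open>\<open>f B = 1\<close> means that the curve has points over \<open>K\<close> above
  \<open>B\<close>. The base of \<open>g B\<close> is \<open>H(B)\<close> times the cube of
  \<open>a1 B * b2 B\<close>, so \<open>g B\<close> is the \<open>e\<close>-th power of
  \<open>H(B)\<close> in polynomial form.\<close>

definition "f B = (a1 B * a2 B) ^ e"
definition "g B = (a1 B ^ 2 * a2 B * b1 B * b2 B ^ 2) ^ e"

lemma fg_values:
  assumes "B \<in> \<Omega>"
  shows "f B = 1 \<or> f B = w \<or> f B = w ^ 2" "g B = 1 \<or> g B = w \<or> g B = w ^ 2"
  using assms factors_in_K[of B] K_power_e[of "a1 B * a2 B"] K_power_e[of "a1 B ^ 2 * a2 B * b1 B * b2 B ^ 2"]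
  by (auto simp: \<Omega>_def f_def g_def K_mult K_power)

text \<open>
  The four lines through the point \<open>(1, w)\<close> of the affine plane of order \<open>3\<close> cover this point four
  times and every other point once.
\<close>

lemma line_count:
  "card {B \<in> \<Omega>. f B = 1} + card {B \<in> \<Omega>. g B = w} + card {B \<in> \<Omega>. f B * g B = w} + card {B \<in> \<Omega>. f B ^ 2 * g B = w}
   = card \<Omega> + 3 * card {B \<in> \<Omega>. f B = 1 \<and> g B = w}"
proof -
  define i where "i P = (if P then 1 else 0 :: nat)" for P
  have card_i: "card {B \<in> \<Omega>. P B} = (\<Sum>B\<in>\<Omega>. i (P B))" for P
    using finite_\<Omega> by (simp add: i_def sum.If_cases Int_def)
  have "i (f B = 1) + i (g B = w) + i (f B * g B = w) + i (f B ^ 2 * g B = w) = 1 + 3 * i (f B = 1 \<and> g B = w)"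
    if "B \<in> \<Omega>" for B
  proof -
    define w' where "w' = w ^ 2"
    have ww: "w * w' = 1" "w' * w = 1" "w' * w' = w" "w * w = w'"
      unfolding w'_def using w by (Groebner_Basis.algebra, Groebner_Basis.algebra, Groebner_Basis.algebra, simp add: power2_eq_square)
    have d: "w \<noteq> 1" "w' \<noteq> 1" "w \<noteq> w'" "1 \<noteq> w" "1 \<noteq> w'" "w' \<noteq> w"
      using w_distinct unfolding w'_def by metis+
    have v: "f B = 1 \<or> f B = w \<or> f B = w'" "g B = 1 \<or> g B = w \<or> g B = w'"
      using fg_values[OF that] by (auto simp: w'_def)
    show ?thesis
      unfolding power2_eq_square i_def using v by (elim disjE) (simp_all add: ww d)
  qed
  then have "(\<Sum>B\<in>\<Omega>. i (f B = 1) + i (g B = w) + i (f B * g B = w) + i (f B ^ 2 * g B = w)) =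
      (\<Sum>B\<in>\<Omega>. 1 + 3 * i (f B = 1 \<and> g B = w))" by (intro sum.cong) auto
  also have "\<dots> = card \<Omega> + 3 * (\<Sum>B\<in>\<Omega>. i (f B = 1 \<and> g B = w))"
    by (simp only: sum.distrib sum_distrib_left card_eq_sum)
  finally show ?thesis unfolding card_i by (simp only: sum.distrib)
qed

text \<open>Up to cubes, the exponents of \<open>a1\<close>, \<open>a2\<close>, \<open>b1\<close>,
  \<open>b2\<close> are \<open>2, 1, 1, 2\<close>, then \<open>0, 2, 1, 2\<close>, then
  \<open>1, 0, 1, 2\<close>. The distinguished factor needs exponent \<open>1\<close> or
  \<open>2\<close>, so \<open>a2\<close> takes this role in the second case.\<close>

lemma class_cards:
  assumes e35: "e \<ge> 35"
  shows "4 * card {B \<in> \<Omega>. g B = w} \<le> 2 * q + 36"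
    and "4 * card {B \<in> \<Omega>. f B * g B = w} \<le> 2 * q + 36"
    and "4 * card {B \<in> \<Omega>. f B ^ 2 * g B = w} \<le> 2 * q + 36"
proof -
  have cK: "- w \<in> K" "- (w ^ 2) \<in> K" "2 * w \<in> K" "2 * w ^ 2 \<in> K"
    using w_in_K by (auto intro!: K_minus K_mult K_power K_numeral)
  have fin: "finite {z \<in> K. P z}" for P using finite_K by simp
  have one: "a1 B ^ (3 * e) = 1" "a2 B ^ (3 * e) = 1" if "B \<in> \<Omega>" for B
    using that factors_in_K[of B] power_3e by (auto simp: \<Omega>_def)
  have "card {B \<in> \<Omega>. g B = w} \<le> card {z \<in> K. z \<noteq> - w \<and> z \<noteq> - (w ^ 2) \<and> z \<noteq> 2 * w \<and> z \<noteq> 2 * w ^ 2 \<and>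
     (z - - w) ^ (2 * e) * (z - - (w ^ 2)) ^ (1 * e) * (z - 2 * w) ^ (1 * e) * (z - 2 * w ^ 2) ^ (2 * e) = w}"
    by (intro card_mono fin) (auto simp: \<Omega>_def factor_defs g_def power_mult_distrib power_mult)
  then show "4 * card {B \<in> \<Omega>. g B = w} \<le> 2 * q + 36"
    using class_card_le[of "-w" "- (w ^ 2)" "2 * w" "2 * w ^ 2" 2 1 1 1 2 1 1 2 1 2 1 1] roots_ne cK e35 by simp
  have "f B * g B = (z - - (w ^ 2)) ^ (2 * e) * (z - - w) ^ (0 * e) * (z - 2 * w) ^ (1 * e) * (z - 2 * w ^ 2) ^ (2 * e)"
    if "B \<in> \<Omega>" "z = B" for B z
  proof -
    have "f B * g B = a1 B ^ (3 * e) * a2 B ^ (2 * e) * b1 B ^ e * b2 B ^ (2 * e)"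
      by (simp add: f_def g_def power_mult power_mult_distrib power2_eq_square power3_eq_cube mult_ac)
    then show ?thesis using that one by (simp add: factor_defs)
  qed
  then have "card {B \<in> \<Omega>. f B * g B = w} \<le> card {z \<in> K. z \<noteq> - (w ^ 2) \<and> z \<noteq> - w \<and> z \<noteq> 2 * w \<and> z \<noteq> 2 * w ^ 2 \<and>
     (z - - (w ^ 2)) ^ (2 * e) * (z - - w) ^ (0 * e) * (z - 2 * w) ^ (1 * e) * (z - 2 * w ^ 2) ^ (2 * e) = w}"
    by (intro card_mono fin) (auto simp: \<Omega>_def factor_defs)
  then show "4 * card {B \<in> \<Omega>. f B * g B = w} \<le> 2 * q + 36"
    using class_card_le[of "- (w ^ 2)" "-w" "2 * w" "2 * w ^ 2" 2 1 1 0 0 0 1 2 1 2 1 1] roots_ne cK e35 by fastforce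
  have "f B ^ 2 * g B = (z - - w) ^ (1 * e) * (z - - (w ^ 2)) ^ (0 * e) * (z - 2 * w) ^ (1 * e) * (z - 2 * w ^ 2) ^ (2 * e)"
    if "B \<in> \<Omega>" "z = B" for B z
  proof -
    have "f B ^ 2 * g B = a1 B ^ (3 * e) * a1 B ^ e * a2 B ^ (3 * e) * b1 B ^ e * b2 B ^ (2 * e)"
      by (simp add: f_def g_def power_mult power_mult_distrib power2_eq_square power3_eq_cube mult_ac)
    then show ?thesis using that one by (simp add: factor_defs)
  qed
  then have "card {B \<in> \<Omega>. f B ^ 2 * g B = w} \<le> card {z \<in> K. z \<noteq> - w \<and> z \<noteq> - (w ^ 2) \<and> z \<noteq> 2 * w \<and> z \<noteq> 2 * w ^ 2 \<and>
     (z - - w) ^ (1 * e) * (z - - (w ^ 2)) ^ (0 * e) * (z - 2 * w) ^ (1 * e) * (z - 2 * w ^ 2) ^ (2 * e) = w}"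
    by (intro card_mono fin) (auto simp: \<Omega>_def factor_defs)
  then show "4 * card {B \<in> \<Omega>. f B ^ 2 * g B = w} \<le> 2 * q + 36"
    using class_card_le[of "-w" "- (w ^ 2)" "2 * w" "2 * w ^ 2" 1 2 1 0 0 0 1 2 1 2 1 1] roots_ne cK e35 by fastforce
qed

text \<open>With \<open>y = B + w\<close> the two factors multiply to \<open>y * (y + d)\<close> for
  \<open>d = w ^ 2 - w\<close>. The \<open>6\<close> pays for \<open>2 * w\<close> and
  \<open>2 * w ^ 2\<close>, which lie outside \<open>\<Omega>\<close>.\<close>

lemma card_f_one: "3 * real (card {B \<in> \<Omega>. f B = 1}) + 6 \<ge> real q - 2 - 2 * sqrt (real q)"
proof -
  let ?T = "{y \<in> K. (y * (y + (w ^ 2 - w))) ^ e = 1}"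
  have d: "w ^ 2 - w \<in> K" "w ^ 2 - w \<noteq> 0" using w_in_K w_distinct by (auto intro!: K_diff K_power)
  have "(\<lambda>y. y - w) ` ?T \<subseteq> {B \<in> \<Omega>. f B = 1} \<union> {2 * w, 2 * w ^ 2}"
  proof
    fix B assume "B \<in> (\<lambda>y. y - w) ` ?T"
    then obtain y where y: "y \<in> K" "(y * (y + (w ^ 2 - w))) ^ e = 1" "B = y - w" by auto
    then have ab: "a1 B = y" "a2 B = y + (w ^ 2 - w)" by (simp_all add: factor_defs)
    then have "a1 B * a2 B \<noteq> 0" using y(2) e_pos by (auto simp: power_0_left)
    then show "B \<in> {B \<in> \<Omega>. f B = 1} \<union> {2 * w, 2 * w ^ 2}"
      using y ab w_in_K by (auto simp: \<Omega>_def f_def b1_def b2_def K_diff)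
  qed
  then have "card ((\<lambda>y. y - w) ` ?T) \<le> card ({B \<in> \<Omega>. f B = 1} \<union> {2 * w, 2 * w ^ 2})"
    using finite_\<Omega> by (intro card_mono) auto
  also have "\<dots> \<le> card {B \<in> \<Omega>. f B = 1} + card {2 * w, 2 * w ^ 2}" by (rule card_Un_le)
  also have "card {2 * w, 2 * w ^ 2} \<le> 2" by (simp add: card_insert_if)
  also have "card ((\<lambda>y. y - w) ` ?T) = card ?T" by (intro card_image) (auto simp: inj_on_def)
  finally have "card ?T \<le> card {B \<in> \<Omega>. f B = 1} + 2" by simp
  then show ?thesis using card_cubic_residues_ge[OF d] by linarith
qed

lemma card_cube_roots:
  assumes "c \<noteq> 0"
  shows "card {A. A ^ 3 = (c::'b)} = 3"
proof -
  obtain r where r: "r ^ 3 = c" using cube_root by blast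
  with assms have "r \<noteq> 0" by auto
  have "{A. A ^ 3 = c} = {r, w * r, w ^ 2 * r}"
  proof (intro equalityI subsetI)
    fix A assume "A \<in> {A. A ^ 3 = c}"
    then have "A ^ 3 = r ^ 3" using r by simp
    then have "(A - r) * (A - w * r) * (A - w ^ 2 * r) = 0" using w by Groebner_Basis.algebra
    then show "A \<in> {r, w * r, w ^ 2 * r}" by auto
  next
    fix A assume "A \<in> {r, w * r, w ^ 2 * r}"
    moreover have "(w * r) ^ 3 = c" "(w ^ 2 * r) ^ 3 = c"
  proof -
    show "(w * r) ^ 3 = c" using r w3 by (simp add: power_mult_distrib)
    have "(w ^ 2 * r) ^ 3 = (w ^ 3) ^ 2 * r ^ 3" by (simp add: power_mult_distrib flip: power_mult)
    then show "(w ^ 2 * r) ^ 3 = c" using r w3 by simp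
  qed
    ultimately show "A \<in> {A. A ^ 3 = c}" using r by auto
  qed
  then show ?thesis using w_distinct \<open>r \<noteq> 0\<close> by (simp add: card_insert_if)
qed

text \<open>Above each \<open>B\<close> with \<open>f B = 1\<close> lie three values of
  \<open>A\<close> in \<open>K\<close>, all good if \<open>g B \<noteq> w\<close> and
  \<open>B\<close> is not \<open>0\<close>, \<open>1\<close> or \<open>-1\<close>; these three
  exceptions cost \<open>9\<close>.\<close>

lemma card_good_pairs:
  "3 * card {B \<in> \<Omega>. f B = 1} \<le> 3 * card {B \<in> \<Omega>. f B = 1 \<and> g B = w} + 9 + card good_pairs"
proof -
  define S where "S = {B \<in> \<Omega>. f B = 1 \<and> g B \<noteq> w} - {0, 1, - 1}"
  define P where "P = (SIGMA B:S. {A. A ^ 3 = - (a1 B * a2 B)})"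
  have S\<Omega>: "B \<in> \<Omega>" if "B \<in> S" for B using that by (simp add: S_def)
  have "{B \<in> \<Omega>. f B = 1} \<subseteq> S \<union> ({B \<in> \<Omega>. f B = 1 \<and> g B = w} \<union> {0, 1, - 1})" by (auto simp: S_def)
  then have "card {B \<in> \<Omega>. f B = 1} \<le> card (S \<union> ({B \<in> \<Omega>. f B = 1 \<and> g B = w} \<union> {0, 1, - 1}))"
    using finite_\<Omega> by (intro card_mono) (auto simp: S_def)
  also have "\<dots> \<le> card S + (card {B \<in> \<Omega>. f B = 1 \<and> g B = w} + card {0, 1, - 1 :: 'b})"
    by (meson card_Un_le add_left_mono order.trans)
  also have "card {0, 1, - 1 :: 'b} \<le> 3" by (simp add: card_insert_if)
  finally have S: "card {B \<in> \<Omega>. f B = 1} \<le> card S + card {B \<in> \<Omega>. f B = 1 \<and> g B = w} + 3" by simp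
  have three: "card {A. A ^ 3 = - (a1 B * a2 B)} = 3" if "B \<in> S" for B
    using S\<Omega>[OF that] by (intro card_cube_roots) (auto simp: \<Omega>_def)
  have "finite {A. A ^ 3 = - (a1 B * a2 B)}" if "B \<in> S" for B
    using three[OF that] by (intro card_ge_0_finite) simp
  then have "card P = (\<Sum>B\<in>S. card {A. A ^ 3 = - (a1 B * a2 B)})"
    unfolding P_def using finite_\<Omega> by (intro card_SigmaI) (auto simp: S_def)
  also have "\<dots> = (\<Sum>B\<in>S. 3)" by (intro sum.cong refl three)
  finally have "card P = 3 * card S" by simp
  moreover have "card P \<le> card good_pairs"
  proof (rule card_inj_on_le[of prod.swap])
    have "(A, B) \<in> good_pairs" if "(B, A) \<in> P" for A B
    proof -
      note that
      then have BS: "B \<in> S" and A3: "A ^ 3 = - (a1 B * a2 B)" by (auto simp: P_def)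
      then have B: "B \<in> \<Omega>" "f B = 1" "g B \<noteq> w" "B \<noteq> 0" "B \<noteq> 1" "B \<noteq> - 1" by (auto simp: S_def)
      have nz: "a1 B \<noteq> 0" "a2 B \<noteq> 0" "b1 B \<noteq> 0" "b2 B \<noteq> 0" and BK: "B \<in> K" using B(1) by (auto simp: \<Omega>_def)
      \<comment> \<open>\<open>-1\<close> is a cube, so the sign in the curve equation does not
        affect the residue class.\<close>
      have "(- 1 :: 'b) ^ e = ((- 1) ^ 3) ^ e" by simp
      also have "\<dots> = (- 1 :: 'b) ^ (3 * e)" by (simp add: power_mult)
      also have "\<dots> = 1" by (intro power_3e K_minus K_1) simp
      finally have "(- (a1 B * a2 B)) ^ e = 1"
        using B(2) power_minus[of "a1 B * a2 B" e] by (simp add: f_def)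
      then have "A ^ (3 * e) = 1" using A3 by (simp add: power_mult)
      then have "A ^ q = A" by (simp add: e)
      then have "A \<in> K" by (simp add: K_def)
      moreover have "(a2 B * b1 B / (a1 B * b2 B)) ^ e \<noteq> w"
      proof -
        have "(a1 B * b2 B) ^ (3 * e) = 1" using factors_in_K[OF BK] nz by (intro power_3e K_mult) auto
        then have "(a2 B * b1 B / (a1 B * b2 B)) ^ e = (a2 B * b1 B / (a1 B * b2 B)) ^ e * ((a1 B * b2 B) ^ 3) ^ e"
          by (simp add: power_mult)
        also have "\<dots> = (a2 B * b1 B / (a1 B * b2 B) * (a1 B * b2 B) ^ 3) ^ e" by (simp only: power_mult_distrib)
        also have "a2 B * b1 B / (a1 B * b2 B) * (a1 B * b2 B) ^ 3 = a1 B ^ 2 * a2 B * b1 B * b2 B ^ 2"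
          using nz by (simp add: power3_eq_cube power2_eq_square)
        finally show ?thesis using B(3) by (simp add: g_def)
      qed
      ultimately show ?thesis
        using good_pairI[of A B e] B A3 e w_in_K by simp
    qed
    then show "prod.swap ` P \<subseteq> good_pairs" by auto
  qed (use finite_good_pairs in auto)
  ultimately show ?thesis using S by linarith
qed

lemma good_pairs_bound_split:
  "real (card good_pairs) \<ge> (real q - 22 * sqrt (real q) - 79) / 6"
proof (cases "sqrt (real q) < 25")
  case True
  from target_nonpos[OF this] show ?thesis by (rule order.trans) simp
next
  case False
  then have "q \<ge> 625" by (rule q_ge_625)
  then have "e \<ge> 35" using e by simp
  note cc = class_cards[OF this]
  let ?N = "real (card {B \<in> \<Omega>. f B = 1})" and ?M = "real (card {B \<in> \<Omega>. f B = 1 \<and> g B = w})"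
  have h1: "?N + real (card {B \<in> \<Omega>. g B = w}) + real (card {B \<in> \<Omega>. f B * g B = w}) + real (card {B \<in> \<Omega>. f B ^ 2 * g B = w})
     = real (card \<Omega>) + 3 * ?M"
    using arg_cong[OF line_count, of real] by simp
  have h2: "4 * real (card {B \<in> \<Omega>. g B = w}) \<le> 2 * real q + 36"
     "4 * real (card {B \<in> \<Omega>. f B * g B = w}) \<le> 2 * real q + 36"
     "4 * real (card {B \<in> \<Omega>. f B ^ 2 * g B = w}) \<le> 2 * real q + 36"
    using cc by linarith+
  have h3: "real q \<le> real (card \<Omega>) + 4" using card_\<Omega> by linarith
  have h4: "3 * ?N \<le> 3 * ?M + 9 + real (card good_pairs)" using card_good_pairs by linarith
  \<comment> \<open>The premises give \<open>G \<ge> (Q - 8 * s - 272) / 6\<close>, and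
    \<open>14 * s \<ge> 193\<close> because \<open>s \<ge> 25\<close>.\<close>
  have "(Q - 22 * s - 79) / 6 \<le> G"
    if "N + n1 + n2 + n3 = W + 3 * M" "4 * n1 \<le> 2 * Q + 36" "4 * n2 \<le> 2 * Q + 36" "4 * n3 \<le> 2 * Q + 36"
      "Q \<le> W + 4" "3 * N \<le> 3 * M + 9 + G" "Q - 2 - 2 * s \<le> 3 * N + 6" "25 \<le> s"
    for Q s G N M W n1 n2 n3 :: real
    using that by (simp add: field_simps)
  from this[OF h1 h2 h3 h4 card_f_one] False show ?thesis by simp
qed

end

section \<open>Counting for \<open>q\<close> congruent to \<open>2\<close> modulo
  \<open>3\<close>\<close>

context fixed_field
begin

text \<open>Every element of \<open>K\<close> has a cube root in \<open>K\<close>, so each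
  admissible \<open>B\<close> contributes a pair. As \<open>3 * e = q + 1\<close>, the
  \<open>3 * e\<close>-th powers of \<open>a1 B * b2 B\<close> and \<open>a2 B * b1 B\<close> are
  norms, both equal to the quartic \<open>\<Delta>\<close>; on the excluded class the two products
  for Stepanov's method are \<open>w ^ 2\<close> and \<open>w\<close> times
  \<open>\<Delta>\<close>.\<close>

lemma good_pairs_bound_inert:
  assumes e: "q + 1 = 3 * e"
  shows "real (card good_pairs) \<ge> (real q - 22 * sqrt (real q) - 79) / 6"
proof (cases "sqrt (real q) < 25")
  case True
  from target_nonpos[OF this] show ?thesis by (rule order.trans) simp
next
  case False
  then have q625: "q \<ge> 625" by (rule q_ge_625)
  have "w ^ q * w = w ^ (q + 1)" by simp
  also have "\<dots> = w ^ 2 * w" unfolding e power_mult using w3 by (simp add: power2_eq_square power3_eq_cube)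
  finally have wq: "w ^ q = w ^ 2" using w_nonzero by simp
  have "(w ^ 2) ^ q = (w ^ q) ^ 2" by (simp add: mult.commute flip: power_mult)
  also have "\<dots> = w" unfolding wq using w by Groebner_Basis.algebra
  finally have w2q: "(w ^ 2) ^ q = w" .
  have diff: "(x - y) ^ q = x ^ q - y ^ q" for x y :: 'b
    using frob_add[of x "-y"] by (simp add: frob_minus)
  have two: "(2::'b) ^ q = 2"
    using K_numeral[of "num.Bit0 num.One"] by (simp add: K_def)
  have conj: "a1 B ^ q = a2 B" "a2 B ^ q = a1 B" "b1 B ^ q = b2 B" "b2 B ^ q = b1 B" if "B \<in> K" for B
    using that unfolding factor_defs by (simp_all add: frob_add diff power_mult_distrib two wq w2q K_def)
  define Bad where "Bad = {B \<in> \<Omega>. (a2 B * b1 B / (a1 B * b2 B)) ^ e = w ^ 2}"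
  define \<Delta> where "\<Delta> = [:w, 1:] * [:w ^ 2, 1:] * [:- 2 * w, 1:] * [:- 2 * w ^ 2, 1:]"
  have poly_\<Delta>: "poly \<Delta> B = a1 B * a2 B * b1 B * b2 B" for B
    unfolding \<Delta>_def poly_mult by (simp add: factor_defs add.commute)
  have deg_\<Delta>: "degree \<Delta> \<le> 4"
    unfolding \<Delta>_def by (intro order.trans[OF degree_mult_le] add_mono[of _ 3 _ 1, simplified]
      add_mono[of _ 2 _ 1, simplified] add_mono[of _ 1 _ 1, simplified]) auto
  have "4 * card Bad \<le> 2 * q + 36"
  proof (rule stepanov_cubic_class[where ?c1.0 = "- w" and ?c2.0 = "- (w ^ 2)" and ?c3.0 = "2 * w" and ?c4.0 = "2 * w ^ 2"
        and ?m1.0 = 2 and ?m2.0 = 1 and ?m3.0 = 1 and ?m4.0 = 2 and ?n1.0 = 1 and ?n2.0 = 2 and ?n3.0 = 2 and ?n4.0 = 1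
        and e = e and \<pi> = "smult (w ^ 2) \<Delta>" and \<rho> = "smult w \<Delta>" and h = h])
    show "degree (smult (w ^ 2) \<Delta>) \<le> 4" "degree (smult w \<Delta>) \<le> 4" using deg_\<Delta> w_nonzero by simp_all
    show "finite Bad" using finite_\<Omega> by (simp add: Bad_def)
    show "z ^ q = z \<and> z \<noteq> - w \<and> z \<noteq> - (w ^ 2) \<and> z \<noteq> 2 * w \<and> z \<noteq> 2 * w ^ 2" if "z \<in> Bad" for z
      using that by (auto simp: Bad_def \<Omega>_def K_def factor_defs)
    show "35 \<le> e" "2 * e + 35 \<le> q" "6 * e \<le> 2 * q + 2" using q625 e by linarith+
    fix z assume z: "z \<in> Bad"
    then have zK: "z \<in> K" and nz: "a1 z \<noteq> 0" "a2 z \<noteq> 0" "b1 z \<noteq> 0" "b2 z \<noteq> 0"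
      and cls: "(a2 z * b1 z / (a1 z * b2 z)) ^ e = w ^ 2" by (auto simp: Bad_def \<Omega>_def)
    have norms: "(a1 z * b2 z) ^ (3 * e) = poly \<Delta> z" "(a2 z * b1 z) ^ (3 * e) = poly \<Delta> z"
      unfolding e[symmetric] poly_\<Delta> by (simp_all add: power_mult_distrib conj[OF zK] mult_ac)
    have "(a1 z ^ 2 * a2 z * b1 z * b2 z ^ 2) ^ e = (a2 z * b1 z / (a1 z * b2 z) * (a1 z * b2 z) ^ 3) ^ e"
      using nz by (simp add: power3_eq_cube power2_eq_square mult_ac)
    also have "\<dots> = w ^ 2 * poly \<Delta> z"
      unfolding power_mult_distrib[of "a2 z * b1 z / (a1 z * b2 z)"] cls power_mult[symmetric] norms ..
    finally show "(z - - w) ^ (2 * e) * (z - - (w ^ 2)) ^ (1 * e) * (z - 2 * w) ^ (1 * e) * (z - 2 * w ^ 2) ^ (2 * e)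
        = poly (smult (w ^ 2) \<Delta>) z"
      by (simp add: factor_defs power_mult_distrib power_mult)
    have "w ^ 2 * (a1 z * b2 z / (a2 z * b1 z)) ^ e = 1"
      unfolding cls[symmetric] power_mult_distrib[symmetric] using nz by simp
    also have "1 = w ^ 2 * w" using w3 by (simp add: power2_eq_square power3_eq_cube)
    finally have cls': "(a1 z * b2 z / (a2 z * b1 z)) ^ e = w" using w_nonzero by simp
    have "(a1 z * a2 z ^ 2 * b1 z ^ 2 * b2 z) ^ e = (a1 z * b2 z / (a2 z * b1 z) * (a2 z * b1 z) ^ 3) ^ e"
      using nz by (simp add: power3_eq_cube power2_eq_square mult_ac)
    also have "\<dots> = w * poly \<Delta> z"
      unfolding power_mult_distrib[of "a1 z * b2 z / (a2 z * b1 z)"] cls' power_mult[symmetric] norms ..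
    finally show "(z - - w) ^ (1 * e) * (z - - (w ^ 2)) ^ (2 * e) * (z - 2 * w) ^ (2 * e) * (z - 2 * w ^ 2) ^ (1 * e)
        = poly (smult w \<Delta>) z"
      by (simp add: factor_defs power_mult_distrib power_mult)
  qed (use roots_ne char q_eq in auto)
  define S where "S = \<Omega> - Bad - {0, 1, - 1}"
  have "\<Omega> \<subseteq> S \<union> (Bad \<union> {0, 1, - 1})" by (auto simp: S_def)
  then have "card \<Omega> \<le> card (S \<union> (Bad \<union> {0, 1, - 1}))"
    using finite_\<Omega> by (intro card_mono) (auto simp: S_def Bad_def)
  also have "\<dots> \<le> card S + (card Bad + card {0, 1, - 1 :: 'b})"
    by (meson card_Un_le add_left_mono order.trans)
  also have "card {0, 1, - 1 :: 'b} \<le> 3" by (simp add: card_insert_if)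
  finally have S: "card \<Omega> \<le> card S + card Bad + 3" by simp
  \<comment> \<open>The exponent satisfies \<open>3 * (2 * e - 1) = 2 * (q - 1) + 1\<close>, which
    makes this power a cube root.\<close>
  define root where "root B = (- (a1 B * a2 B)) ^ (2 * e - 1)" for B
  have "card S \<le> card good_pairs"
  proof (rule card_inj_on_le[of "\<lambda>B. (root B, B)"])
    show "(\<lambda>B. (root B, B)) ` S \<subseteq> good_pairs"
    proof clarify
      fix B assume "B \<in> S"
      then have B: "B \<in> \<Omega>" "B \<noteq> 0" "B \<noteq> 1" "B \<noteq> - 1" "(a2 B * b1 B / (a1 B * b2 B)) ^ e \<noteq> w ^ 2"
        by (auto simp: S_def Bad_def)
      then have BK: "B \<in> K" and nz: "a1 B * a2 B \<noteq> 0" by (auto simp: \<Omega>_def)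
      let ?c = "- (a1 B * a2 B)"
      have cK: "?c \<in> K"
        using conj[OF BK] by (simp add: K_def frob_minus power_mult_distrib mult.commute)
      have "3 * (2 * e - 1) = (q - 1) * 2 + 1" using e q625 by (simp add: diff_mult_distrib2)
      then have "root B ^ 3 = ((?c) ^ (q - 1)) ^ 2 * ?c"
        unfolding root_def power_mult[symmetric] mult.commute[of _ 3] by (simp only: power_add power_one_right)
      also have "\<dots> = ?c" using K_power_minus_one[OF cK] nz by simp
      finally have "root B ^ 3 = ?c" .
      moreover have "root B \<in> K" unfolding root_def using cK by (rule K_power)
      ultimately show "(root B, B) \<in> good_pairs"
        using good_pairI[of "root B" B e] B e wq by simp
    qed
  qed (use finite_good_pairs in \<open>auto intro: inj_onI\<close>)
  \<comment> \<open>From at least \<open>q - 4\<close> values, at most \<open>q / 2 + 9\<close> bad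
    ones and three exceptions are removed.\<close>
  with S \<open>4 * card Bad \<le> 2 * q + 36\<close> card_\<Omega> have "q \<le> 2 * card good_pairs + 32" by linarith
  then have "real q \<le> 2 * real (card good_pairs) + 32" by linarith
  then show ?thesis using False q625 by (simp add: field_simps)
qed

end

lemma (in fixed_field) good_pairs_bound:
  "real (card good_pairs) \<ge> (real q - 22 * sqrt (real q) - 79) / 6"
proof -
  have "\<not> 3 dvd CHAR('b)" using char primes_dvd_imp_eq[of 3 "CHAR('b)"] by auto
  then have "\<not> 3 dvd q" unfolding q_eq using prime_dvd_power[of 3 "CHAR('b)" h] by auto
  then consider e where "q = 3 * e + 1" | e where "q + 1 = 3 * e"
  proof -
    assume *: "\<And>e. q = 3 * e + 1 \<Longrightarrow> thesis" "\<And>e. q + 1 = 3 * e \<Longrightarrow> thesis" and "\<not> 3 dvd q"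
    then have "q = 3 * (q div 3) + 1 \<or> q + 1 = 3 * (q div 3 + 1)" by presburger
    then show thesis using * by blast
  qed
  then show ?thesis
  proof cases
    case 1
    interpret split_fixed_field q h w e by unfold_locales (rule 1)
    show ?thesis by (rule good_pairs_bound_split)
  next
    case 2
    then show ?thesis by (rule good_pairs_bound_inert)
  qed
qed

section \<open>Descent from the algebraic closure to the given field\<close>

lemma subfield_power_card:
  fixes Fq :: "'a::field set"
  assumes sub: "is_subfield Fq" and fin: "finite Fq" and x: "x \<in> Fq"
  shows "x ^ card Fq = x"
proof (cases "x = 0")
  case True
  then show ?thesis using fin x by (auto simp: power_0_left card_eq_0_iff)
next
  case False
  have mult: "a * b \<in> Fq" if "a \<in> Fq" "b \<in> Fq" for a b using sub that by (auto simp: is_subfield_def)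
  have inv: "inverse a \<in> Fq" if "a \<in> Fq" for a using sub that by (auto simp: is_subfield_def)
  \<comment> \<open>Multiplication by \<open>x\<close> permutes the nonzero elements.\<close>
  have "(\<Prod>y\<in>Fq - {0}. x * y) = \<Prod>(Fq - {0})"
    using False x mult inv
    by (intro prod.reindex_bij_witness[of _ "\<lambda>y. inverse x * y" "\<lambda>y. x * y"]) (auto simp flip: mult.assoc)
  then have "x ^ card (Fq - {0}) * \<Prod>(Fq - {0}) = 1 * \<Prod>(Fq - {0})" by (simp add: prod.distrib)
  moreover have "\<Prod>(Fq - {0}) \<noteq> 0" using fin by simp
  ultimately have "x ^ card (Fq - {0}) = 1" by simp
  moreover have "card Fq = Suc (card (Fq - {0}))"
    using fin sub card_Suc_Diff1[of Fq 0] by (simp add: is_subfield_def)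
  ultimately show ?thesis by simp
qed

lemma card_power_fixed_le:
  assumes "n > 1"
  shows "finite {x::'b::field. x ^ n = x}" "card {x::'b. x ^ n = x} \<le> n"
proof -
  let ?p = "monom 1 n - monom 1 1 :: 'b poly"
  have ne: "?p \<noteq> 0"
  proof
    assume "?p = 0"
    then have "degree (monom (1::'b) n) = degree (monom (1::'b) 1)" by simp
    then show False using assms by (simp add: degree_monom_eq)
  qed
  have eq: "{x::'b. x ^ n = x} = {x. poly ?p x = 0}" by (auto simp: poly_monom)
  show "finite {x::'b::field. x ^ n = x}" unfolding eq using ne by (rule poly_roots_finite)
  have "card {x. poly ?p x = 0} \<le> degree ?p" using ne by (rule card_poly_roots_bound)
  also have "\<dots> \<le> n" using assms by (intro degree_diff_le) (auto intro: order.trans[OF degree_monom_le])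
  finally show "card {x::'b. x ^ n = x} \<le> n" unfolding eq .
qed

theorem theorem3p3:
  fixes p h q :: nat
    and Fq :: "'a::finite_field set"
  assumes "prime p" and "p > 3" and "h > 0" and "q = p ^ h"
    and "card (UNIV :: 'a set) = q ^ 3"
    and "is_subfield Fq" and "card Fq = q"
  shows "real (card {(A, B). A \<in> Fq \<and> B \<in> Fq \<and> A ^ 3 + B ^ 2 - B + 1 = 0 \<and>
                       B \<noteq> 0 \<and> B \<noteq> - 1 \<and> permutation_poly (f2 q A B)})
         \<ge> (real q - 22 * sqrt (real q) - 79) / 6"
    (is "_ \<le> real (card ?P)")
proof -
  have "CHAR('a) dvd p ^ (h * 3)"
    using CHAR_dvd_CARD[where 'a = 'a] assms(4,5) by (simp add: power_mult)
  then have "CHAR('a) dvd p"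
    using prime_dvd_power[of "CHAR('a)" p] prime_CHAR_semidom[where 'a = 'a] by (simp add: CHAR_pos_iff)
  then have char_a: "CHAR('a) = p"
    using primes_dvd_imp_eq[of "CHAR('a)" p] prime_CHAR_semidom[where 'a = 'a] assms(1) by simp
  then have char: "CHAR('a alg_closure) = p" by simp
  have "p ^ 1 \<le> q" unfolding assms(4) using assms by (intro power_increasing) auto
  then have q: "q > 3" using assms(2) by simp
  have fq: "x ^ q = x" if "x \<in> Fq" for x
    using subfield_power_card[OF assms(6) _ that] assms(7) by simp
  \<comment> \<open>The field itself need not contain a primitive cube root of unity, nor a cube root of \<open>H(B)\<close>.\<close>
  let ?K = "{x :: 'a alg_closure. x ^ q = x}"
  have img: "to_ac ` Fq \<subseteq> ?K" using fq by (auto simp flip: to_ac_power)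
  have card_img: "card (to_ac ` Fq) = q" using card_image[of to_ac Fq] inj_to_ac assms(7) by (auto simp: inj_on_def)
  \<comment> \<open>The \<open>q\<close> images are roots of \<open>X ^ q - X\<close>, which has at
    most \<open>q\<close> roots.\<close>
  have K: "to_ac ` Fq = ?K"
    using card_power_fixed_le[of q, where 'b = "'a alg_closure"] q card_img img
    by (intro card_seteq) auto
  obtain w :: "'a alg_closure" where w: "poly [:1, 1, 1:] w = 0"
    using alg_closed_imp_poly_has_root[of "[:1, 1, 1:] :: 'a alg_closure poly"] by auto
  interpret fixed_field q h w
  proof
    show "card ?K = q" using K card_img by simp
    show "w ^ 2 + w + 1 = 0" using w by (simp add: power2_eq_square algebra_simps)
    show "\<exists>t. t ^ 3 = x" for x :: "'a alg_closure" by (rule nth_root_exists) simp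
  qed (use char assms in auto)
  \<comment> \<open>Every good pair descends along the embedding, which carries evaluation of the
    polynomial into the closure and reflects equality.\<close>
  have "good_pairs \<subseteq> map_prod to_ac to_ac ` ?P"
  proof
    fix z assume "z \<in> good_pairs"
    then obtain A' B' where z: "z = (A', B')" "A' \<in> K" "B' \<in> K" "A' ^ 3 + B' ^ 2 - B' + 1 = 0"
      "B' \<noteq> 0" "B' \<noteq> - 1" "permuting A' B'" by (auto simp: good_pairs_def)
    then have "A' \<in> to_ac ` Fq" "B' \<in> to_ac ` Fq" unfolding K by (simp_all add: K_def)
    then obtain A B where AB: "A \<in> Fq" "A' = to_ac A" "B \<in> Fq" "B' = to_ac B" by blast
    have "to_ac (A ^ 3 + B ^ 2 - B + 1) = to_ac 0" "B \<noteq> 0" "to_ac B \<noteq> to_ac (- 1)"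
      using z AB by auto
    moreover have "permutation_poly (f2 q A B)"
    proof -
      have to_ac_poly: "to_ac (poly (f2 q A B) x) =
          to_ac x ^ (q ^ 2 + q - 1) + A' * to_ac x ^ (q ^ 3 - q ^ 2 + q) + B' * to_ac x" for x
        by (simp add: f2_def poly_monom AB)
      have x3: "to_ac x ^ q ^ 3 = to_ac x" for x :: 'a
        using finite_field_power_card_eq_same[of x] assms(5) by (simp flip: to_ac_power)
      have "inj (poly (f2 q A B))"
      proof (rule injI)
        fix x y assume "poly (f2 q A B) x = poly (f2 q A B) y"
        then have "to_ac (poly (f2 q A B) x) = to_ac (poly (f2 q A B) y)" by simp
        then have "to_ac x = to_ac y"
          unfolding to_ac_poly using z(7) x3 unfolding permuting_def inj_on_def by blast
        then show "x = y" by simp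
      qed
      then show ?thesis unfolding permutation_poly_def by (simp add: bij_def finite_UNIV_inj_surj)
    qed
    ultimately have "(A, B) \<in> ?P" using AB by (simp only: to_ac_eq_iff) auto
    then show "z \<in> map_prod to_ac to_ac ` ?P" using z(1) AB(2,4) by (intro image_eqI[of _ _ "(A, B)"]) simp_all
  qed
  moreover have "finite ?P" by simp
  ultimately have "card good_pairs \<le> card (map_prod to_ac to_ac ` ?P)" by (intro card_mono) auto
  also have "\<dots> \<le> card ?P" by (rule card_image_le) fact
  finally show ?thesis using good_pairs_bound by linarith
qed

end
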